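(* Assume: (A1) $X\subset\mathbb{R}^d$ is a nonempty closed convex set onto which the projection can be easily computed; (A2) $f:\mathbb{R}^d\to\mathbb{R}$, $f(\mathbf{x}):=\mathbb{E}[F(\mathbf{x},\boldsymbol{\xi})]$, is well defined, where $F(\cdot,\boldsymbol{\xi})$ is continuously differentiable for almost every $\boldsymbol{\xi}\in\Xi$; (A3) $h_{n+1,i}\ge h_{n,i}$ almost surely for all $n\in\mathbb{N}$ and all $i=1,\dots,d$; (A4) for all $i=1,\dots,d$ there is a positive number $B_i$ with $\sup\{\mathbb{E}[h_{n,i}]:n\in\mathbb{N}\}\le B_i$; (A5) $D:=\max_{i=1,\dots,d}\sup\{(x_i-y_i)^2:(x_j)_j,(y_j)_j\in X\}<+\infty$; (C1) $\boldsymbol{\xi}_0,\boldsymbol{\xi}_1,\dots$ is an independent and identically distributed sample of realizations of $\boldsymbol{\xi}$; (C2) there is an oracle which, for a given $(\mathbf{x},\boldsymbol{\xi})\in\mathbb{R}^d\times\Xi$, returns a stochastic gradient $\mathsf{G}(\mathbf{x},\boldsymbol{\xi})$ with $\mathbb{E}[\mathsf{G}(\mathbf{x},\boldsymbol{\xi})]=\nabla f(\mathbf{x})$; (C3) there is a positive number $M$ such that $\mathbb{E}[\|\mathsf{G}(\mathbf{x},\boldsymbol{\xi})\|^2]\le M^2$ for all $\mathbf{x}\in X$. Let $(\mathbf{x}_n)_{n\in\mathbb{N}}$ be the sequence generated by the algorithm described in the context with $\alpha_n:=\alpha\in(0,1)$ and $\beta_n:=\beta\in[0,1)$ for all $n\in\mathbb{N}$,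 and with $\gamma\in[0,1)$. Then, for all $\mathbf{x}\in X$, $$\limsup_{n\to+\infty}\mathbb{E}\left[\langle \mathbf{x}-\mathbf{x}_n,\nabla f(\mathbf{x}_n)\rangle\right]\ \ge\ -\frac{\tilde B^2\tilde M^2}{2\tilde b\tilde\gamma^2}\,\alpha-\frac{\tilde M\sqrt{Dd}}{\tilde b\tilde\gamma}\,\beta,$$ where $\tilde\gamma:=1-\gamma$, $\tilde b:=1-\beta$, $\tilde M^2:=\max\{\|\mathbf{m}_{-1}\|^2,M^2\}$ (with $\tilde M\ge0$), and $\tilde B:=\sup\{\max_{i=1,\dots,d}h_{n,i}^{-1/2}:n\in\mathbb{N}\}<+\infty$.
   Context: $\mathbb{N}=\{0,1,2,\dots\}$; $\langle\cdot,\cdot\rangle$ and $\|\cdot\|$ are the Euclidean inner product and norm on $\mathbb{R}^d$. For a symmetric positive-definite matrix $H$, $\|\mathbf{x}\|_H^2:=\langle\mathbf{x},H\mathbf{x}\rangle$, and $P_{X,H}$ is the metric projection onto $X$ under the norm $\|\cdot\|_H$. $\boldsymbol{\xi}$ is a random vector whose distribution is supported on a set $\Xi\subset\mathbb{R}^{d_1}$, and $\nabla f$ is the gradient of $f$. Algorithm. Parameters: $(\alpha_n)_{n\in\mathbb{N}}\subset(0,1)$, $(\beta_n)_{n\in\mathbb{N}}\subset[0,1)$, $\gamma\in[0,1)$. Initialize with $\mathbf{x}_0,\mathbf{m}_{-1}\in\mathbb{R}^d$ and a symmetric positive-definite diagonal $d\times d$ matrix $\mathsf{H}_0$. For $n=0,1,2,\dots$: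 set $$\mathbf{m}_n:=\beta_n\mathbf{m}_{n-1}+(1-\beta_n)\mathsf{G}(\mathbf{x}_n,\boldsymbol{\xi}_n),\qquad \hat{\mathbf{m}}_n:=\frac{\mathbf{m}_n}{1-\gamma^{n+1}};$$ take a (possibly random) symmetric positive-definite diagonal matrix $\mathsf{H}_n=\mathrm{diag}(h_{n,1},\dots,h_{n,d})$, $h_{n,i}>0$; find $\mathbf{d}_n\in\mathbb{R}^d$ solving $\mathsf{H}_n\mathbf{d}=-\hat{\mathbf{m}}_n$; set $\mathbf{x}_{n+1}:=P_{X,\mathsf{H}_n}(\mathbf{x}_n+\alpha_n\mathbf{d}_n)$. The iterate $\mathbf{x}_n$ is a function of $(\boldsymbol{\xi}_0,\dots,\boldsymbol{\xi}_{n-1})$. *)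

theory Defs
  imports "HOL-Probability.Probability"
begin

definition gradient :: "('a::euclidean_space \<Rightarrow> real) \<Rightarrow> 'a \<Rightarrow> 'a" where
  "gradient f x = (THE g. GDERIV f x :> g)"

definition continuously_differentiable :: "('a::euclidean_space \<Rightarrow> real) \<Rightarrow> bool" where
  "continuously_differentiable f \<longleftrightarrow>
     (\<forall>x. f differentiable (at x)) \<and> continuous_on UNIV (gradient f)"

definition diag_mat :: "real ^ 'd \<Rightarrow> real ^ 'd ^ 'd" where
  "diag_mat v = (\<chi> i j. if i = j then v $ i else 0)"

definition norm_wrt :: "real ^ 'd ^ 'd \<Rightarrow> real ^ 'd \<Rightarrow> real" where
  "norm_wrt H x = sqrt (x \<bullet> (H *v x))"

text \<open>
  The metric projection onto \<open>X\<close> under \<open>norm_wrt H\<close>. For \<open>H\<close> symmetric positive definite and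
  \<open>X\<close> nonempty, closed and convex, the minimizer exists and is unique.
\<close>
definition proj_wrt :: "(real ^ 'd) set \<Rightarrow> real ^ 'd ^ 'd \<Rightarrow> real ^ 'd \<Rightarrow> real ^ 'd" where
  "proj_wrt X H y = arg_min_on (\<lambda>z. norm_wrt H (y - z)) X"

text \<open>
  One run of the algorithm: \<open>u n\<close> is the sample drawn in step \<open>n\<close>, and \<open>m0\<close> is the initial
  momentum, i.e. the vector that carries the index \<open>-1\<close>.
\<close>
definition algorithm_run ::
  "(real ^ 'd) set \<Rightarrow> (real ^ 'd \<Rightarrow> 'k \<Rightarrow> real ^ 'd) \<Rightarrow>
   (nat \<Rightarrow> real) \<Rightarrow> (nat \<Rightarrow> real) \<Rightarrow> real \<Rightarrow> real ^ 'd \<Rightarrow> real ^ 'd \<Rightarrow>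
   (nat \<Rightarrow> 'k) \<Rightarrow> (nat \<Rightarrow> real ^ 'd ^ 'd) \<Rightarrow>
   (nat \<Rightarrow> real ^ 'd) \<Rightarrow> (nat \<Rightarrow> real ^ 'd) \<Rightarrow> (nat \<Rightarrow> real ^ 'd) \<Rightarrow> bool" where
  "algorithm_run X G \<alpha> \<beta> \<gamma> x0 m0 u H x m d \<longleftrightarrow>
     x 0 = x0 \<and>
     (\<forall>n. m n = \<beta> n *\<^sub>R (case n of 0 \<Rightarrow> m0 | Suc k \<Rightarrow> m k) + (1 - \<beta> n) *\<^sub>R G (x n) (u n)) \<and>
     (\<forall>n. H n *v d n = - (m n /\<^sub>R (1 - \<gamma> ^ (n + 1)))) \<and>
     (\<forall>n. x (Suc n) = proj_wrt X (H n) (x n + \<alpha> n *\<^sub>R d n))"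

definition coord_diameter_sq :: "(real ^ 'd) set \<Rightarrow> ereal" where
  "coord_diameter_sq X =
     Max (range (\<lambda>i. SUP (x, y) \<in> X \<times> X. ereal ((x $ i - y $ i)\<^sup>2)))"

text \<open>
  The constant written as the supremum over \<open>n\<close> of the maximum over \<open>i\<close> of \<open>h n i powr (-1/2)\<close>.
  As the \<open>h n i\<close> are random and the constant is not, the supremum is the essential one with
  respect to the outcome. If \<open>h 0\<close> is deterministic and \<open>h\<close> is almost surely nondecreasing in
  \<open>n\<close>, this is just the maximum over \<open>i\<close> of \<open>h 0 i powr (-1/2)\<close>, which is finite.
\<close>
definition inv_sqrt_bound :: "'w measure \<Rightarrow> (nat \<Rightarrow> 'w \<Rightarrow> real ^ 'd) \<Rightarrow> ereal" where
  "inv_sqrt_bound P h =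
     esssup P (\<lambda>\<omega>. SUP n. Max (range (\<lambda>i. ereal ((h n \<omega> $ i) powr (- 1 / 2)))))"

end

theory Submission
  imports Defs
begin

text \<open>
  The projection onto \<open>X\<close> is nonexpansive for the weighted norm in which it is taken, so one step of
  the algorithm satisfies, for every \<open>y\<close> in \<open>X\<close>, the descent inequality
  \<open>2\<alpha> \<langle>x\<^sub>n - y, m\<^sub>n / a\<^sub>n\<rangle> \<le> \<parallel>x\<^sub>n - y\<parallel>\<^sup>2 - \<parallel>x\<^sub>n\<^sub>+\<^sub>1 - y\<parallel>\<^sup>2 + \<alpha>\<^sup>2 K \<parallel>m\<^sub>n / a\<^sub>n\<parallel>\<^sup>2\<close>, where both
  distances are weighted by \<open>h\<^sub>n\<close>, \<open>a\<^sub>n = 1 - \<gamma>^(n+1)\<close> and \<open>K\<close> bounds all \<open>1 / h\<^sub>n\<^sub>,\<^sub>i\<close>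
  (\<open>projected_step_descent\<close>). As \<open>m\<^sub>n\<close> is \<open>\<beta> m\<^sub>n\<^sub>-\<^sub>1\<close> plus \<open>1 - \<beta>\<close> times an unbiased gradient sample, the
  left-hand side contains, in expectation, the gap \<open>e\<^sub>n = E \<langle>x\<^sub>n - y, \<nabla>f(x\<^sub>n)\<rangle>\<close>; the old momentum
  costs at most \<open>\<beta>\<close> times the diameter bound of \<open>X\<close> times \<open>E \<parallel>m\<^sub>n\<^sub>-\<^sub>1\<parallel>\<close>. The second moment of the momentum is
  controlled by convexity of the squared norm (\<open>momentum_second_moment\<close>).
  
  The distances on the right are weighted by the same \<open>h\<^sub>n\<close>, hence do not telescope by themselves.
  Since \<open>h\<^sub>n\<close> increases and \<open>X\<close> has bounded coordinate widths, replacing \<open>h\<^sub>n\<close> by \<open>h\<^sub>n\<^sub>+\<^sub>1\<close> in the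
  second distance costs at most \<open>D\<close> times the increase of \<open>\<Sum>\<^sub>i E h\<^sub>n\<^sub>,\<^sub>i\<close> (\<open>weighted_distance_potential\<close>). So the expected distance
  minus \<open>D \<Sum>\<^sub>i E h\<^sub>n\<^sub>,\<^sub>i\<close> is a potential, bounded below because these expectations are bounded, and the
  result has the form \<open>e\<^sub>n \<le> c + \<Psi>\<^sub>n - \<Psi>\<^sub>n\<^sub>+\<^sub>1\<close> whenever \<open>e\<^sub>n \<ge> 0\<close> (\<open>kept_gap_bound\<close>). If the limit superior of
  \<open>- e\<^sub>n\<close> were smaller than \<open>- c\<close>, the potential would eventually decrease by a fixed amount in every
  step, which is impossible (\<open>not_eventually_potential_decrease\<close>).
  
  One point needs care: the starting point \<open>x\<^sub>0\<close> need not lie in \<open>X\<close>, so the first gradient sample,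
  which every \<open>m\<^sub>n\<close> contains with weight of order \<open>\<beta>^n\<close>, is integrable but may fail to be square
  integrable. All expectations are therefore taken on the event that this sample has norm at most
  \<open>R\<close>. On this event \<open>m\<^sub>0\<close> is bounded and its influence decays like \<open>\<beta>^n\<close>, which is absorbed into the
  potential \<open>\<Psi>\<close>. The event belongs to the past of every later step, so unbiasedness survives the
  restriction, and the complement changes the gap by \<open>O(1/R)\<close>, uniformly in \<open>n\<close>
  (\<open>truncation_error\<close>). The initial momentum is forgotten in the same way; what remains of the
  momentum in the limit is the moment bound \<open>M\<close>, and \<open>M\<close> is at most the constant of the claim.
\<close>

section \<open>Projection in a diagonally weighted norm\<close>

definition diag_norm_sq :: "real ^ 'd \<Rightarrow> real ^ 'd \<Rightarrow> real" where
  "diag_norm_sq v z = (\<Sum>i\<in>UNIV. v $ i * (z $ i)\<^sup>2)"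

text \<open>
  The linear map that turns the weighted norm into the Euclidean one: the weighted projection onto
  \<open>X\<close> is the Euclidean projection onto the image of \<open>X\<close>.
\<close>
definition sqrt_scale :: "real ^ 'd \<Rightarrow> real ^ 'd \<Rightarrow> real ^ 'd" where
  "sqrt_scale v z = (\<chi> i. sqrt (v $ i) * z $ i)"

lemma diag_mat_mult_nth: "(diag_mat v *v z) $ i = v $ i * z $ i"
  by (simp add: diag_mat_def matrix_vector_mult_def if_distrib[where f="\<lambda>a. a * _"] cong: if_cong)

lemma norm_sq_vec: "(norm (z :: real ^ 'd))\<^sup>2 = (\<Sum>i\<in>UNIV. (z $ i)\<^sup>2)"
  unfolding power2_norm_eq_inner by (simp add: inner_vec_def power2_eq_square)

lemma diag_norm_sq_nonneg: "(\<And>i. 0 \<le> v $ i) \<Longrightarrow> 0 \<le> diag_norm_sq v z"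
  by (auto simp: diag_norm_sq_def intro!: sum_nonneg)

lemma diag_norm_sq_eq_norm_sqrt_scale:
  assumes "\<And>i. 0 \<le> v $ i"
  shows "diag_norm_sq v z = (norm (sqrt_scale v z))\<^sup>2"
  using assms by (simp add: norm_sq_vec diag_norm_sq_def sqrt_scale_def power_mult_distrib)

lemma norm_wrt_diag_mat:
  assumes "\<And>i. 0 \<le> v $ i"
  shows "norm_wrt (diag_mat v) z = norm (sqrt_scale v z)"
proof -
  have "z \<bullet> (diag_mat v *v z) = diag_norm_sq v z"
    by (simp add: inner_vec_def diag_mat_mult_nth diag_norm_sq_def power2_eq_square algebra_simps)
  then show ?thesis
    by (simp add: norm_wrt_def diag_norm_sq_eq_norm_sqrt_scale[OF assms])
qed

lemma linear_sqrt_scale: "linear (sqrt_scale v)"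
  by (rule linearI) (simp_all add: sqrt_scale_def vec_eq_iff algebra_simps)

text \<open>
  The minimum defining the projection is attained by compactness of \<open>X\<close>.
\<close>
lemma proj_wrt_minimizes:
  assumes "compact X" "X \<noteq> {}" "\<And>i. 0 \<le> v $ i"
  shows "proj_wrt X (diag_mat v) y \<in> X"
    and "z \<in> X \<Longrightarrow> norm_wrt (diag_mat v) (y - proj_wrt X (diag_mat v) y) \<le> norm_wrt (diag_mat v) (y - z)"
proof -
  let ?g = "\<lambda>z. norm_wrt (diag_mat v) (y - z)"
  have "continuous_on X (\<lambda>z. norm (sqrt_scale v (y - z)))"
    by (intro continuous_intros linear_continuous_on_compose[OF _ linear_sqrt_scale])
  then have "continuous_on X ?g"
    by (simp add: norm_wrt_diag_mat[OF assms(3)])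
  from continuous_attains_inf[OF assms(1,2) this]
  obtain q where "q \<in> X" "\<And>z. z \<in> X \<Longrightarrow> ?g q \<le> ?g z" by blast
  then have "is_arg_min ?g (\<lambda>z. z \<in> X) q"
    by (auto simp: is_arg_min_linorder)
  then have "is_arg_min ?g (\<lambda>z. z \<in> X) (proj_wrt X (diag_mat v) y)"
    unfolding proj_wrt_def arg_min_on_def arg_min_def by (rule someI)
  then show "proj_wrt X (diag_mat v) y \<in> X"
    and "z \<in> X \<Longrightarrow> ?g (proj_wrt X (diag_mat v) y) \<le> ?g z"
    by (auto simp: is_arg_min_linorder)
qed

text \<open>
  After rescaling the coordinates this is the obtuse-angle property of Euclidean projections: at the
  projected point \<open>q\<close> the angle between \<open>y - q\<close> and \<open>z - q\<close> is at least a right angle, so \<open>q\<close> is at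
  least as close to \<open>z\<close> as \<open>y\<close> is.
\<close>
lemma proj_wrt_nonexpansive:
  assumes X: "compact X" "convex X" and v: "\<And>i. 0 \<le> v $ i" and z: "z \<in> X"
  shows "diag_norm_sq v (proj_wrt X (diag_mat v) y - z) \<le> diag_norm_sq v (y - z)"
proof -
  let ?T = "sqrt_scale v" and ?q = "proj_wrt X (diag_mat v) y"
  interpret T: linear ?T by (rule linear_sqrt_scale)
  have ne: "X \<noteq> {}" using z by auto
  note q = proj_wrt_minimizes[OF X(1) ne v]
  have "dist (?T y) (?T ?q) \<le> dist (?T y) (?T w)" if "w \<in> X" for w
    using q(2)[OF that] by (simp add: norm_wrt_diag_mat[OF v] dist_norm T.diff)
  moreover have "convex (?T ` X)"
    by (rule convex_linear_image[OF linear_sqrt_scale X(2)])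
  moreover have "closed (?T ` X)"
    using X(1) linear_sqrt_scale
    by (intro compact_imp_closed compact_continuous_image linear_continuous_on) (simp_all add: linear_conv_bounded_linear)
  ultimately have "(?T y - ?T ?q) \<bullet> (?T z - ?T ?q) \<le> 0"
    using q(1) z by (intro any_closest_point_dot[of "?T ` X"]) auto
  moreover have "(norm (?T y - ?T z))\<^sup>2 = (norm (?T y - ?T ?q))\<^sup>2 + (norm (?T ?q - ?T z))\<^sup>2
      - 2 * ((?T y - ?T ?q) \<bullet> (?T z - ?T ?q))"
    unfolding power2_norm_eq_inner by (simp add: inner_diff_left inner_diff_right inner_commute)
  ultimately have "(norm (?T ?q - ?T z))\<^sup>2 \<le> (norm (?T y - ?T z))\<^sup>2"
    using zero_le_power2[of "norm (?T y - ?T ?q)"] by linarith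
  then show ?thesis
    by (simp add: diag_norm_sq_eq_norm_sqrt_scale[OF v] T.diff)
qed

text \<open>
  Expanding the squared weighted distance of the unprojected point from \<open>z\<close>, the cross term is
  exactly the Euclidean inner product with \<open>g\<close>, because \<open>diag_mat v\<close> cancels against the definition
  of \<open>d\<close>; the projection then only brings the point closer to \<open>z\<close>.
\<close>
lemma projected_step_descent:
  assumes X: "compact X" "convex X" and v: "\<And>i. 0 < v $ i" and z: "z \<in> X"
    and d: "diag_mat v *v d = - g" and K: "\<And>i. inverse (v $ i) \<le> K"
  shows "2 * \<alpha> * ((x - z) \<bullet> g)
    \<le> diag_norm_sq v (x - z) - diag_norm_sq v (proj_wrt X (diag_mat v) (x + \<alpha> *\<^sub>R d) - z)
       + \<alpha>\<^sup>2 * K * (norm g)\<^sup>2"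
proof -
  have dg: "v $ i * d $ i = - g $ i" for i
    using d by (metis diag_mat_mult_nth vector_uminus_component)
  have "diag_norm_sq v (x + \<alpha> *\<^sub>R d - z)
      = diag_norm_sq v (x - z) - 2 * \<alpha> * ((x - z) \<bullet> g) + \<alpha>\<^sup>2 * diag_norm_sq v d"
  proof -
    have "v $ i * (x $ i + \<alpha> * d $ i - z $ i)\<^sup>2
        = v $ i * (x $ i - z $ i)\<^sup>2 - 2 * \<alpha> * ((x $ i - z $ i) * g $ i) + \<alpha>\<^sup>2 * (v $ i * (d $ i)\<^sup>2)" for i
    proof -
      have g: "g $ i = - (v $ i * d $ i)" using dg[of i] by simp
      show ?thesis unfolding g power2_eq_square by (simp add: algebra_simps)
    qed
    then show ?thesis
      by (simp add: diag_norm_sq_def inner_vec_def sum.distrib sum_subtractf sum_distrib_left)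
  qed
  moreover have "diag_norm_sq v d \<le> K * (norm g)\<^sup>2"
  proof -
    have "v $ i * (d $ i)\<^sup>2 \<le> K * (g $ i)\<^sup>2" for i
    proof -
      have "v $ i * (d $ i)\<^sup>2 = inverse (v $ i) * (v $ i * d $ i)\<^sup>2"
        using v[of i] by (simp add: power2_eq_square field_simps)
      also have "\<dots> \<le> K * (v $ i * d $ i)\<^sup>2"
        by (intro mult_right_mono K) simp
      finally show ?thesis by (simp add: dg)
    qed
    then show ?thesis
      by (simp add: diag_norm_sq_def norm_sq_vec sum_distrib_left sum_mono)
  qed
  then have "\<alpha>\<^sup>2 * diag_norm_sq v d \<le> \<alpha>\<^sup>2 * K * (norm g)\<^sup>2"
    by (simp add: mult_left_mono mult.assoc)
  moreover have "diag_norm_sq v (proj_wrt X (diag_mat v) (x + \<alpha> *\<^sub>R d) - z)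
      \<le> diag_norm_sq v (x + \<alpha> *\<^sub>R d - z)"
    using v by (intro proj_wrt_nonexpansive X z) (simp add: less_imp_le)
  ultimately show ?thesis by linarith
qed

section \<open>The two extended-real constants\<close>

lemma coord_diameter_sq_bound:
  assumes fin: "coord_diameter_sq X < \<infinity>" and x: "x \<in> X" and y: "y \<in> X"
  shows "(x $ i - y $ i)\<^sup>2 \<le> real_of_ereal (coord_diameter_sq X)"
proof -
  let ?s = "\<lambda>i. SUP (x, y) \<in> X \<times> X. ereal ((x $ i - y $ i)\<^sup>2)"
  have "ereal ((x $ i - y $ i)\<^sup>2) \<le> ?s i"
    using x y by (intro SUP_upper2[of "(x, y)"]) auto
  also have "\<dots> \<le> coord_diameter_sq X"
    unfolding coord_diameter_sq_def by (intro Max_ge) auto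
  finally have le: "ereal ((x $ i - y $ i)\<^sup>2) \<le> coord_diameter_sq X" .
  then show ?thesis
    using fin by (cases "coord_diameter_sq X") auto
qed

lemma norm_sq_le_coord_bound:
  fixes z :: "real ^ 'd"
  assumes "\<And>i. (z $ i)\<^sup>2 \<le> D"
  shows "norm z \<le> sqrt (D * real CARD('d))"
proof -
  have "(norm z)\<^sup>2 \<le> (\<Sum>i\<in>(UNIV::'d set). D)"
    unfolding norm_sq_vec by (intro sum_mono assms)
  then show ?thesis
    by (intro real_le_rsqrt) (simp add: mult.commute)
qed

text \<open>
  The essential supremum dominates almost every value, and squaring the power with exponent \<open>- 1 / 2\<close>
  gives the inverse.
\<close>
lemma inv_sqrt_bound_AE:
  fixes h :: "nat \<Rightarrow> 'w \<Rightarrow> real ^ 'd"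
  assumes P: "prob_space P"
    and pos: "\<And>n \<omega> i. \<omega> \<in> space P \<Longrightarrow> 0 < h n \<omega> $ i"
    and fin: "inv_sqrt_bound P h < \<infinity>"
  shows "AE \<omega> in P. \<forall>n i. inverse (h n \<omega> $ i) \<le> (real_of_ereal (inv_sqrt_bound P h))\<^sup>2"
proof -
  let ?s = "\<lambda>\<omega>. SUP n. Max (range (\<lambda>i. ereal ((h n \<omega> $ i) powr (- 1 / 2))))"
  have le: "ereal ((h n \<omega> $ i) powr (- 1 / 2)) \<le> ?s \<omega>" for n \<omega> i
  proof -
    have "ereal ((h n \<omega> $ i) powr (- 1 / 2)) \<le> Max (range (\<lambda>i. ereal ((h n \<omega> $ i) powr (- 1 / 2))))"
      by (intro Max_ge) auto
    also have "\<dots> \<le> ?s \<omega>" by (intro SUP_upper) auto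
    finally show ?thesis .
  qed
  have "AE \<omega> in P. ?s \<omega> \<le> inv_sqrt_bound P h"
    unfolding inv_sqrt_bound_def by (rule esssup_AE)
  then show ?thesis
  proof (rule AE_mp, intro AE_I2 impI allI)
    fix \<omega> n i assume \<omega>: "\<omega> \<in> space P" and s: "?s \<omega> \<le> inv_sqrt_bound P h"
    define c where "c = (h n \<omega> $ i) powr (- 1 / 2)"
    have "ereal c \<le> inv_sqrt_bound P h"
      using le[of n \<omega> i] s unfolding c_def by (rule order_trans)
    then have "c \<le> real_of_ereal (inv_sqrt_bound P h)"
      using fin by (cases "inv_sqrt_bound P h") auto
    moreover have "0 \<le> c" by (simp add: c_def)
    ultimately have "c\<^sup>2 \<le> (real_of_ereal (inv_sqrt_bound P h))\<^sup>2"
      by (intro power_mono)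
    moreover have "c\<^sup>2 = inverse (h n \<omega> $ i)"
    proof -
      have "c\<^sup>2 = (h n \<omega> $ i) powr (- 1 / 2 + - 1 / 2)"
        unfolding c_def power2_eq_square powr_add ..
      also have "\<dots> = inverse (h n \<omega> $ i)"
        using pos[OF \<omega>, of n i] by (simp add: powr_minus)
      finally show ?thesis .
    qed
    ultimately show "inverse (h n \<omega> $ i) \<le> (real_of_ereal (inv_sqrt_bound P h))\<^sup>2" by simp
  qed
qed

section \<open>Freezing an independent argument\<close>

context prob_space
begin

text \<open>
  Independence of the family gives independence of the past and the one-element family indexed by
  \<open>n\<close>; reading off the only coordinate of the latter turns it into the value at \<open>n\<close>.
\<close>
lemma indep_vars_past_present:
  fixes Z :: "nat \<Rightarrow> 'a \<Rightarrow> 'c::topological_space"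
  assumes ind: "indep_vars (\<lambda>_. borel) Z UNIV"
  shows "distr M (Pi\<^sub>M {..<n} (\<lambda>_. borel) \<Otimes>\<^sub>M borel) (\<lambda>\<omega>. (\<lambda>k\<in>{..<n}. Z k \<omega>, Z n \<omega>))
    = distr M (Pi\<^sub>M {..<n} (\<lambda>_. borel)) (\<lambda>\<omega>. \<lambda>k\<in>{..<n}. Z k \<omega>) \<Otimes>\<^sub>M distr M borel (Z n)"
proof -
  let ?U = "\<lambda>\<omega>. \<lambda>k\<in>{..<n}. Z k \<omega>" and ?V = "\<lambda>\<omega>. \<lambda>k\<in>{n}. Z k \<omega>"
  let ?N = "Pi\<^sub>M {..<n} (\<lambda>_. borel) :: (nat \<Rightarrow> 'c) measure" and ?S = "Pi\<^sub>M {n} (\<lambda>_. borel) :: (nat \<Rightarrow> 'c) measure"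
  have [measurable]: "Z k \<in> borel_measurable M" for k
    using ind by (simp add: indep_vars_def)
  have ev: "(\<lambda>v. v n) \<in> measurable ?S borel" by measurable
  interpret V: prob_space "distr M borel (Z n)" by (rule prob_space_distr) measurable
  have V: "distr (distr M ?S ?V) borel (\<lambda>v. v n) = distr M borel (Z n)"
    by (subst distr_distr) (auto simp: comp_def intro!: distr_cong)
  have "distr M ?N ?U \<Otimes>\<^sub>M distr M borel (Z n)
      = distr (distr M ?N ?U) ?N (\<lambda>u. u) \<Otimes>\<^sub>M distr (distr M ?S ?V) borel (\<lambda>v. v n)"
    unfolding V by (simp add: distr_distr comp_def)
  also have "\<dots> = distr (distr M ?N ?U \<Otimes>\<^sub>M distr M ?S ?V) (?N \<Otimes>\<^sub>M borel) (\<lambda>(u, v). (u, v n))"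
    by (rule pair_measure_distr) (use ev in \<open>auto simp: V intro: V.sigma_finite_measure_axioms\<close>)
  also have "distr M ?N ?U \<Otimes>\<^sub>M distr M ?S ?V = distr M (?N \<Otimes>\<^sub>M ?S) (\<lambda>\<omega>. (?U \<omega>, ?V \<omega>))"
    using indep_var_restrict[OF ind, of "{..<n}" "{n}"] by (simp add: indep_var_distribution_eq)
  also have "distr \<dots> (?N \<Otimes>\<^sub>M borel) (\<lambda>(u, v). (u, v n)) = distr M (?N \<Otimes>\<^sub>M borel) (\<lambda>\<omega>. (?U \<omega>, Z n \<omega>))"
    by (subst distr_distr) (auto simp: comp_def)
  finally show ?thesis ..
qed

text \<open>
  When \<open>U\<close> and \<open>V\<close> are independent, the expectation of a function of both may be computed by freezing
  \<open>U\<close>, averaging over the other argument, and then averaging over \<open>U\<close>. In the inner average any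
  \<open>V'\<close> with the law of \<open>V\<close> may stand in for \<open>V\<close>.
\<close>
lemma nn_integral_freeze:
  assumes U: "U \<in> measurable M N" and V: "V \<in> measurable M S" and V': "V' \<in> measurable M S"
    and law: "distr M (N \<Otimes>\<^sub>M S) (\<lambda>\<omega>. (U \<omega>, V \<omega>)) = distr M N U \<Otimes>\<^sub>M distr M S V'"
    and g[measurable]: "g \<in> borel_measurable (N \<Otimes>\<^sub>M S)"
  shows "(\<integral>\<^sup>+\<omega>. g (U \<omega>, V \<omega>) \<partial>M) = (\<integral>\<^sup>+\<omega>. (\<integral>\<^sup>+\<omega>'. g (U \<omega>, V' \<omega>') \<partial>M) \<partial>M)"
proof -
  note [measurable] = U V V'
  interpret V': prob_space "distr M S V'" by (rule prob_space_distr) measurable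
  have "(\<integral>\<^sup>+\<omega>. g (U \<omega>, V \<omega>) \<partial>M) = (\<integral>\<^sup>+p. g p \<partial>(distr M N U \<Otimes>\<^sub>M distr M S V'))"
    unfolding law[symmetric] by (subst nn_integral_distr) auto
  also have "\<dots> = (\<integral>\<^sup>+u. (\<integral>\<^sup>+z. g (u, z) \<partial>distr M S V') \<partial>distr M N U)"
    by (subst V'.nn_integral_fst[symmetric]) auto
  also have "\<dots> = (\<integral>\<^sup>+\<omega>. (\<integral>\<^sup>+z. g (U \<omega>, z) \<partial>distr M S V') \<partial>M)"
    by (subst nn_integral_distr) auto
  also have "\<dots> = (\<integral>\<^sup>+\<omega>. (\<integral>\<^sup>+\<omega>'. g (U \<omega>, V' \<omega>') \<partial>M) \<partial>M)"
  proof (rule nn_integral_cong)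
    fix \<omega> assume "\<omega> \<in> space M"
    then have [simp]: "U \<omega> \<in> space N"
      by (rule measurable_space[OF U])
    show "(\<integral>\<^sup>+z. g (U \<omega>, z) \<partial>distr M S V') = (\<integral>\<^sup>+\<omega>'. g (U \<omega>, V' \<omega>') \<partial>M)"
      by (subst nn_integral_distr) auto
  qed
  finally show ?thesis .
qed

lemma integral_freeze:
  fixes g :: "_ \<Rightarrow> real"
  assumes U: "U \<in> measurable M N" and V: "V \<in> measurable M S" and V': "V' \<in> measurable M S"
    and law: "distr M (N \<Otimes>\<^sub>M S) (\<lambda>\<omega>. (U \<omega>, V \<omega>)) = distr M N U \<Otimes>\<^sub>M distr M S V'"
    and g[measurable]: "g \<in> borel_measurable (N \<Otimes>\<^sub>M S)"
    and int: "integrable M (\<lambda>\<omega>. g (U \<omega>, V \<omega>))"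
  shows "(\<integral>\<omega>. g (U \<omega>, V \<omega>) \<partial>M) = (\<integral>\<omega>. (\<integral>\<omega>'. g (U \<omega>, V' \<omega>') \<partial>M) \<partial>M)"
proof -
  note [measurable] = U V V'
  interpret U: prob_space "distr M N U" by (rule prob_space_distr) measurable
  interpret V': prob_space "distr M S V'" by (rule prob_space_distr) measurable
  interpret UV: pair_sigma_finite "distr M N U" "distr M S V'" ..
  have "integrable (distr M N U \<Otimes>\<^sub>M distr M S V') g"
    unfolding law[symmetric] using int by (subst integrable_distr_eq) auto
  note fst = UV.integral_fst'[OF this]
  have "(\<integral>\<omega>. g (U \<omega>, V \<omega>) \<partial>M) = (\<integral>p. g p \<partial>(distr M N U \<Otimes>\<^sub>M distr M S V'))"
    unfolding law[symmetric] by (subst integral_distr) auto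
  also have "\<dots> = (\<integral>u. (\<integral>z. g (u, z) \<partial>distr M S V') \<partial>distr M N U)"
    by (rule fst[symmetric])
  also have "\<dots> = (\<integral>\<omega>. (\<integral>z. g (U \<omega>, z) \<partial>distr M S V') \<partial>M)"
    by (subst integral_distr) auto
  also have "\<dots> = (\<integral>\<omega>. (\<integral>\<omega>'. g (U \<omega>, V' \<omega>') \<partial>M) \<partial>M)"
  proof (rule Bochner_Integration.integral_cong[OF refl])
    fix \<omega> assume "\<omega> \<in> space M"
    then have [simp]: "U \<omega> \<in> space N"
      by (rule measurable_space[OF U])
    show "(\<integral>z. g (U \<omega>, z) \<partial>distr M S V') = (\<integral>\<omega>'. g (U \<omega>, V' \<omega>') \<partial>M)"
      by (subst integral_distr) auto
  qed
  finally show ?thesis .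
qed

section \<open>Moments of the momentum\<close>

text \<open>
  The first moment is bounded by the inequality \<open>2t \<le> t\<^sup>2 / c + c\<close>. Compared with the Cauchy-Schwarz
  bound it is affine in the second moment, so a geometrically decaying excess of the second moment
  over \<open>c\<^sup>2\<close> becomes a geometrically decaying excess of the first moment over \<open>c\<close>.
\<close>
lemma integral_norm_le_second_moment:
  fixes f :: "'a \<Rightarrow> 'b::euclidean_space"
  assumes [measurable]: "f \<in> borel_measurable M" and sq: "integrable M (\<lambda>\<omega>. (norm (f \<omega>))\<^sup>2)"
    and c: "0 < c"
  shows "integrable M f" and "(\<integral>\<omega>. norm (f \<omega>) \<partial>M) \<le> ((\<integral>\<omega>. (norm (f \<omega>))\<^sup>2 \<partial>M) / c + c) / 2"
proof -
  have "integrable M (\<lambda>\<omega>. norm (f \<omega>))"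
    by (rule square_integrable_imp_integrable[OF _ sq]) measurable
  then show i: "integrable M f" by (simp add: integrable_norm_iff)
  have "(\<integral>\<omega>. norm (f \<omega>) \<partial>M) \<le> (\<integral>\<omega>. ((norm (f \<omega>))\<^sup>2 / c + c) / 2 \<partial>M)"
  proof (rule integral_mono)
    show "norm (f \<omega>) \<le> ((norm (f \<omega>))\<^sup>2 / c + c) / 2" for \<omega>
      using zero_le_power2[of "norm (f \<omega>) - c"] c
      by (simp add: field_simps power2_eq_square)
  qed (use sq i in auto)
  also have "\<dots> = ((\<integral>\<omega>. (norm (f \<omega>))\<^sup>2 \<partial>M) / c + c) / 2"
    using sq by (simp add: prob_space)
  finally show "(\<integral>\<omega>. norm (f \<omega>) \<partial>M) \<le> ((\<integral>\<omega>. (norm (f \<omega>))\<^sup>2 \<partial>M) / c + c) / 2" .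
qed

text \<open>
  By convexity of the squared norm, the second moment of \<open>p (Suc n)\<close> is at most the
  \<open>\<beta>\<close>-weighted mean of that of \<open>p n\<close> and \<open>K\<close>; hence its excess over \<open>K\<close> shrinks by the factor
  \<open>\<beta>\<close> in each step.
\<close>
lemma momentum_second_moment:
  fixes p g :: "nat \<Rightarrow> 'a \<Rightarrow> 'b::euclidean_space"
  assumes [measurable]: "\<And>n. p n \<in> borel_measurable M" "\<And>n. g n \<in> borel_measurable M"
    and step: "\<And>n \<omega>. \<omega> \<in> space M \<Longrightarrow> p (Suc n) \<omega> = \<beta> *\<^sub>R p n \<omega> + (1 - \<beta>) *\<^sub>R g (Suc n) \<omega>"
    and \<beta>: "0 \<le> \<beta>" "\<beta> \<le> 1"
    and g: "\<And>n. integrable M (\<lambda>\<omega>. (norm (g (Suc n) \<omega>))\<^sup>2)" "\<And>n. (\<integral>\<omega>. (norm (g (Suc n) \<omega>))\<^sup>2 \<partial>M) \<le> K"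
    and p0: "integrable M (\<lambda>\<omega>. (norm (p 0 \<omega>))\<^sup>2)" "(\<integral>\<omega>. (norm (p 0 \<omega>))\<^sup>2 \<partial>M) \<le> K + C"
  shows "integrable M (\<lambda>\<omega>. (norm (p n \<omega>))\<^sup>2) \<and> (\<integral>\<omega>. (norm (p n \<omega>))\<^sup>2 \<partial>M) \<le> K + \<beta> ^ n * C"
proof (induction n)
  case 0
  then show ?case using p0 by simp
next
  case (Suc n)
  note IH = conjunct1[OF Suc.IH] conjunct2[OF Suc.IH]
  have conv: "(norm (p (Suc n) \<omega>))\<^sup>2 \<le> \<beta> * (norm (p n \<omega>))\<^sup>2 + (1 - \<beta>) * (norm (g (Suc n) \<omega>))\<^sup>2"
    if "\<omega> \<in> space M" for \<omega>
  proof -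
    let ?a = "p n \<omega>" and ?b = "g (Suc n) \<omega>"
    have "\<beta> * (norm ?a)\<^sup>2 + (1 - \<beta>) * (norm ?b)\<^sup>2 - (norm (\<beta> *\<^sub>R ?a + (1 - \<beta>) *\<^sub>R ?b))\<^sup>2
        = \<beta> * (1 - \<beta>) * (norm (?a - ?b))\<^sup>2"
      unfolding power2_norm_eq_inner
      by (simp add: inner_add_left inner_add_right inner_diff_left inner_diff_right inner_commute algebra_simps)
    moreover have "0 \<le> \<beta> * (1 - \<beta>) * (norm (?a - ?b))\<^sup>2" using \<beta> by simp
    ultimately show ?thesis using step[OF that] by simp
  qed
  have int: "integrable M (\<lambda>\<omega>. \<beta> * (norm (p n \<omega>))\<^sup>2 + (1 - \<beta>) * (norm (g (Suc n) \<omega>))\<^sup>2)"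
    using IH(1) g(1) by auto
  have int': "integrable M (\<lambda>\<omega>. (norm (p (Suc n) \<omega>))\<^sup>2)"
    by (rule Bochner_Integration.integrable_bound[OF int]) (use conv in \<open>auto intro!: AE_I2 order_trans[OF _ abs_ge_self]\<close>)
  have "(\<integral>\<omega>. (norm (p (Suc n) \<omega>))\<^sup>2 \<partial>M)
      \<le> (\<integral>\<omega>. \<beta> * (norm (p n \<omega>))\<^sup>2 + (1 - \<beta>) * (norm (g (Suc n) \<omega>))\<^sup>2 \<partial>M)"
    by (rule integral_mono[OF int' int conv])
  also have "\<dots> = \<beta> * (\<integral>\<omega>. (norm (p n \<omega>))\<^sup>2 \<partial>M) + (1 - \<beta>) * (\<integral>\<omega>. (norm (g (Suc n) \<omega>))\<^sup>2 \<partial>M)"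
    using IH(1) g(1) by simp
  also have "\<dots> \<le> \<beta> * (K + \<beta> ^ n * C) + (1 - \<beta>) * K"
    using IH(2) g(2) \<beta> by (intro add_mono mult_left_mono) auto
  also have "\<dots> = K + \<beta> ^ Suc n * C" by (simp add: algebra_simps)
  finally show ?case using int' by simp
qed

end

section \<open>The potential argument\<close>

lemma not_eventually_potential_decrease:
  fixes \<Psi> :: "nat \<Rightarrow> real"
  assumes lower: "\<And>n. L \<le> \<Psi> n" and \<delta>: "0 < \<delta>"
    and dec: "eventually (\<lambda>n. \<delta> \<le> \<Psi> n - \<Psi> (Suc n)) sequentially"
  shows False
proof -
  obtain N where N: "\<And>n. N \<le> n \<Longrightarrow> \<delta> \<le> \<Psi> n - \<Psi> (Suc n)"
    using dec by (auto simp: eventually_sequentially)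
  have "real k * \<delta> \<le> \<Psi> N - \<Psi> (N + k)" for k
  proof (induction k)
    case (Suc k)
    then show ?case using N[of "N + k"] by (simp add: algebra_simps)
  qed simp
  then have "real k * \<delta> \<le> \<Psi> N - L" for k
    using lower[of "N + k"] by (meson diff_left_mono order_trans)
  moreover obtain k where "\<Psi> N - L < real k * \<delta>"
    using reals_Archimedean3[OF \<delta>] by blast
  ultimately show False by (meson not_less)
qed

lemma diag_norm_sq_le:
  assumes "\<And>i. 0 \<le> v $ i" "\<And>i. (z $ i)\<^sup>2 \<le> D"
  shows "diag_norm_sq v z \<le> D * (\<Sum>i\<in>UNIV. v $ i)"
  using assms by (auto simp: diag_norm_sq_def sum_distrib_left mult.commute[of D] intro!: sum_mono mult_left_mono)

lemma measurable_vec_nth [measurable (raw)]: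
  fixes v :: "'w \<Rightarrow> real ^ 'd"
  assumes [measurable]: "v \<in> borel_measurable P"
  shows "(\<lambda>\<omega>. v \<omega> $ i) \<in> borel_measurable P"
proof -
  have "(\<lambda>\<omega>. v \<omega> \<bullet> axis i 1) \<in> borel_measurable P" by measurable
  then show ?thesis by (simp add: inner_axis)
qed

lemma measurable_diag_norm_sq [measurable (raw)]:
  fixes v z :: "'w \<Rightarrow> real ^ 'd"
  assumes [measurable]: "v \<in> borel_measurable P" "z \<in> borel_measurable P"
  shows "(\<lambda>\<omega>. diag_norm_sq (v \<omega>) (z \<omega>)) \<in> borel_measurable P"
  unfolding diag_norm_sq_def by measurable

lemma integrable_weighted_diag_norm_sq:
  fixes v z :: "'w \<Rightarrow> real ^ 'd" and w :: "'w \<Rightarrow> real"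
  assumes [measurable]: "v \<in> borel_measurable P" "z \<in> borel_measurable P" "w \<in> borel_measurable P"
    and w: "\<And>\<omega>. 0 \<le> w \<omega>" "\<And>\<omega>. w \<omega> \<le> 1"
    and int: "\<And>i. integrable P (\<lambda>\<omega>. v \<omega> $ i)"
    and nonneg: "\<And>\<omega> i. \<omega> \<in> space P \<Longrightarrow> 0 \<le> v \<omega> $ i"
    and z: "\<And>\<omega> i. \<omega> \<in> space P \<Longrightarrow> (z \<omega> $ i)\<^sup>2 \<le> D"
  shows "integrable P (\<lambda>\<omega>. w \<omega> * diag_norm_sq (v \<omega>) (z \<omega>))"
    and "0 \<le> (\<integral>\<omega>. w \<omega> * diag_norm_sq (v \<omega>) (z \<omega>) \<partial>P)"
proof -
  have nn: "0 \<le> w \<omega> * diag_norm_sq (v \<omega>) (z \<omega>)" if "\<omega> \<in> space P" for \<omega>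
    using nonneg[OF that] w by (auto intro!: mult_nonneg_nonneg diag_norm_sq_nonneg)
  then show "0 \<le> (\<integral>\<omega>. w \<omega> * diag_norm_sq (v \<omega>) (z \<omega>) \<partial>P)"
    by (intro integral_nonneg_AE AE_I2) auto
  show "integrable P (\<lambda>\<omega>. w \<omega> * diag_norm_sq (v \<omega>) (z \<omega>))"
  proof (rule Bochner_Integration.integrable_bound)
    show "integrable P (\<lambda>\<omega>. D * (\<Sum>i\<in>UNIV. v \<omega> $ i))"
      using int by auto
    show "AE \<omega> in P. norm (w \<omega> * diag_norm_sq (v \<omega>) (z \<omega>)) \<le> norm (D * (\<Sum>i\<in>UNIV. v \<omega> $ i))"
    proof (rule AE_I2)
      fix \<omega> assume \<omega>: "\<omega> \<in> space P"
      have "w \<omega> * diag_norm_sq (v \<omega>) (z \<omega>) \<le> 1 * diag_norm_sq (v \<omega>) (z \<omega>)"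
        using nonneg[OF \<omega>] w by (intro mult_right_mono diag_norm_sq_nonneg)
      also have "\<dots> \<le> D * (\<Sum>i\<in>UNIV. v \<omega> $ i)"
        using diag_norm_sq_le[OF nonneg[OF \<omega>] z[OF \<omega>]] by simp
      finally show "norm (w \<omega> * diag_norm_sq (v \<omega>) (z \<omega>)) \<le> norm (D * (\<Sum>i\<in>UNIV. v \<omega> $ i))"
        using nn[OF \<omega>] by simp
    qed
  qed measurable
qed

text \<open>
  Increasing the weights from \<open>h\<close> to \<open>h'\<close> raises the squared distance by the squared coordinates
  weighted with the nonnegative increments, and each squared coordinate is at most \<open>D\<close>. Subtracting
  \<open>D\<close> times the expected weights compensates for this, which lets the distances telescope.
\<close>
lemma weighted_distance_potential:
  fixes P :: "'w measure" and h h' z :: "'w \<Rightarrow> real ^ 'd" and w :: "'w \<Rightarrow> real"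
  assumes [measurable]: "h \<in> borel_measurable P" "h' \<in> borel_measurable P" "z \<in> borel_measurable P"
      "w \<in> borel_measurable P"
    and w: "\<And>\<omega>. 0 \<le> w \<omega>" "\<And>\<omega>. w \<omega> \<le> 1"
    and int: "\<And>i. integrable P (\<lambda>\<omega>. h \<omega> $ i)" "\<And>i. integrable P (\<lambda>\<omega>. h' \<omega> $ i)"
    and nonneg: "\<And>\<omega> i. \<omega> \<in> space P \<Longrightarrow> 0 \<le> h \<omega> $ i" "\<And>\<omega> i. \<omega> \<in> space P \<Longrightarrow> 0 \<le> h' \<omega> $ i"
    and mono: "\<And>i. AE \<omega> in P. h \<omega> $ i \<le> h' \<omega> $ i"
    and z: "\<And>\<omega> i. \<omega> \<in> space P \<Longrightarrow> (z \<omega> $ i)\<^sup>2 \<le> D"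
  shows "(\<integral>\<omega>. w \<omega> * diag_norm_sq (h' \<omega>) (z \<omega>) \<partial>P) - D * (\<Sum>i\<in>UNIV. \<integral>\<omega>. h' \<omega> $ i \<partial>P)
    \<le> (\<integral>\<omega>. w \<omega> * diag_norm_sq (h \<omega>) (z \<omega>) \<partial>P) - D * (\<Sum>i\<in>UNIV. \<integral>\<omega>. h \<omega> $ i \<partial>P)"
proof -
  let ?N = "\<lambda>v \<omega>. w \<omega> * diag_norm_sq (v \<omega>) (z \<omega>)"
  have iN: "integrable P (?N h)" "integrable P (?N h')"
    using integrable_weighted_diag_norm_sq(1)[of h P z w D] integrable_weighted_diag_norm_sq(1)[of h' P z w D]
      assms by auto
  have "(\<integral>\<omega>. ?N h' \<omega> - ?N h \<omega> \<partial>P) \<le> (\<integral>\<omega>. D * (\<Sum>i\<in>UNIV. h' \<omega> $ i) - D * (\<Sum>i\<in>UNIV. h \<omega> $ i) \<partial>P)"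
  proof (rule integral_mono_AE)
    have "AE \<omega> in P. \<forall>i. h \<omega> $ i \<le> h' \<omega> $ i"
      using mono by (simp add: AE_all_countable)
    then show "AE \<omega> in P. ?N h' \<omega> - ?N h \<omega> \<le> D * (\<Sum>i\<in>UNIV. h' \<omega> $ i) - D * (\<Sum>i\<in>UNIV. h \<omega> $ i)"
    proof (rule AE_mp, intro AE_I2 impI)
      fix \<omega> assume \<omega>: "\<omega> \<in> space P" and le: "\<forall>i. h \<omega> $ i \<le> h' \<omega> $ i"
      have "?N h' \<omega> - ?N h \<omega> = w \<omega> * diag_norm_sq (h' \<omega> - h \<omega>) (z \<omega>)"
        by (simp add: diag_norm_sq_def left_diff_distrib right_diff_distrib sum_subtractf)
      also have "\<dots> \<le> 1 * diag_norm_sq (h' \<omega> - h \<omega>) (z \<omega>)"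
        using le w by (intro mult_right_mono diag_norm_sq_nonneg) auto
      also have "\<dots> \<le> D * (\<Sum>i\<in>UNIV. (h' \<omega> - h \<omega>) $ i)"
        using diag_norm_sq_le[OF _ z[OF \<omega>], of "h' \<omega> - h \<omega>"] le by simp
      finally show "?N h' \<omega> - ?N h \<omega> \<le> D * (\<Sum>i\<in>UNIV. h' \<omega> $ i) - D * (\<Sum>i\<in>UNIV. h \<omega> $ i)"
        by (simp add: sum_subtractf right_diff_distrib)
    qed
  qed (use iN int in auto)
  then show ?thesis
    using iN int by (simp add: Bochner_Integration.integral_sum)
qed

section \<open>From the descent inequality to a bound on the gap\<close>

text \<open>
  The arithmetic that combines the descent inequality with the moment bounds. Here \<open>e\<close> is the gap,
  \<open>a\<close> the bias correction with lower bound \<open>g\<close>, \<open>b = 1 - \<beta>\<close>, \<open>I\<close> and \<open>J\<close> are the expected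
  inner products with the new and the old momentum, \<open>S\<close> is the second moment of the new and \<open>N\<close> the
  first moment of the old one, and \<open>q = \<beta>^n\<close> is the decaying influence of the start.
\<close>
lemma gap_bound_arith:
  fixes a e I J S N \<Delta> \<alpha> \<beta> b g K \<rho> M C q :: real
  assumes a: "g \<le> a" "a \<le> 1" and pos: "0 < g" "0 < b" "0 < \<alpha>" "0 \<le> \<beta>" "0 \<le> K" "0 < M" "0 \<le> \<rho>"
    and descent: "2 * \<alpha> * (I / a) \<le> \<Delta> + \<alpha>\<^sup>2 * K * (S / a\<^sup>2)"
    and split: "I = \<beta> * J + b * e" and J: "- (\<rho> * N) \<le> J"
    and S: "0 \<le> S" "S \<le> M\<^sup>2 + q * \<beta> * C" and N: "0 \<le> N" "N \<le> M + q * C / (2 * M)"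
    and e: "0 \<le> e"
  shows "e \<le> K * M\<^sup>2 / (2 * b * g\<^sup>2) * \<alpha> + M * \<rho> / (b * g) * \<beta>
    + \<Delta> / (2 * \<alpha> * b) + (\<alpha> * K * \<beta> * C / (2 * g\<^sup>2) + \<beta> * \<rho> * C / (2 * M * g)) / b * q"
proof -
  have a0: "0 < a" using a pos by linarith
  \<comment> \<open>Nonnegativity of the gap allows dividing by the bias correction, after which the
    telescoping difference carries a weight that does not depend on the step.\<close>
  have "b * e \<le> b * e / a"
    using e pos(2) a(2) a0 by (simp add: pos_le_divide_eq mult_left_le)
  also have "\<dots> = I / a - \<beta> * J / a"
    unfolding split by (simp add: add_divide_distrib)
  also have "\<dots> \<le> (\<Delta> / (2 * \<alpha>) + \<alpha> * K / 2 * (S / a\<^sup>2)) + \<beta> * \<rho> * (N / a)"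
  proof (rule diff_le_eq[THEN iffD2], rule order_trans)
    have "2 * \<alpha> * (I / a) / (2 * \<alpha>) \<le> (\<Delta> + \<alpha>\<^sup>2 * K * (S / a\<^sup>2)) / (2 * \<alpha>)"
      by (intro divide_right_mono descent) (use pos in simp)
    then show "I / a \<le> \<Delta> / (2 * \<alpha>) + \<alpha> * K / 2 * (S / a\<^sup>2)"
      using pos(3) by (simp add: add_divide_distrib power2_eq_square mult.assoc)
    have "\<beta> * (- (\<rho> * N)) / a \<le> \<beta> * J / a"
      using J pos(4) a0 by (intro divide_right_mono mult_left_mono) auto
    then show "\<Delta> / (2 * \<alpha>) + \<alpha> * K / 2 * (S / a\<^sup>2)
        \<le> \<Delta> / (2 * \<alpha>) + \<alpha> * K / 2 * (S / a\<^sup>2) + \<beta> * \<rho> * (N / a) + \<beta> * J / a"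
      by simp
  qed
  also have "\<dots> \<le> \<Delta> / (2 * \<alpha>) + \<alpha> * K / 2 * ((M\<^sup>2 + q * \<beta> * C) / g\<^sup>2) + \<beta> * \<rho> * ((M + q * C / (2 * M)) / g)"
    using S N a pos
    by (intro add_mono order_refl mult_left_mono frac_le power_mono) auto
  also have "\<dots> = b * (K * M\<^sup>2 / (2 * b * g\<^sup>2) * \<alpha> + M * \<rho> / (b * g) * \<beta>
    + \<Delta> / (2 * \<alpha> * b) + (\<alpha> * K * \<beta> * C / (2 * g\<^sup>2) + \<beta> * \<rho> * C / (2 * M * g)) / b * q)"
    using pos by (simp add: field_simps power2_eq_square)
  finally show ?thesis using pos(2) by simp
qed

section \<open>Runs in a bounded set\<close>

text \<open>
  The hypotheses in the form in which the argument uses them: \<open>K\<close> bounds the inverse weights and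
  \<open>T\<close> bounds the sum of the expected weights.
\<close>
locale bounded_momentum_run = prob_space P for P :: "'w measure" +
  fixes X :: "(real ^ 'd) set" and \<xi> :: "'w \<Rightarrow> 'k::euclidean_space" and \<xi>s :: "nat \<Rightarrow> 'w \<Rightarrow> 'k"
    and G :: "real ^ 'd \<Rightarrow> 'k \<Rightarrow> real ^ 'd" and h x m d :: "nat \<Rightarrow> 'w \<Rightarrow> real ^ 'd"
    and x0 m0 :: "real ^ 'd" and \<alpha> \<beta> \<gamma> M D K T :: real
  assumes compact_X: "compact X" and convex_X: "convex X" and X_ne: "X \<noteq> {}"
    and D: "\<And>z z' i. z \<in> X \<Longrightarrow> z' \<in> X \<Longrightarrow> (z $ i - z' $ i)\<^sup>2 \<le> D"
    and h_rv [measurable]: "\<And>n. h n \<in> borel_measurable P"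
    and h_pos: "\<And>n \<omega> i. \<omega> \<in> space P \<Longrightarrow> h n \<omega> $ i > 0"
    and h_mono: "\<And>n i. AE \<omega> in P. h n \<omega> $ i \<le> h (Suc n) \<omega> $ i"
    and h_int: "\<And>n i. integrable P (\<lambda>\<omega>. h n \<omega> $ i)"
    and h_bound: "\<And>n. (\<Sum>i\<in>UNIV. \<integral>\<omega>. h n \<omega> $ i \<partial>P) \<le> T"
    and K: "AE \<omega> in P. \<forall>n i. inverse (h n \<omega> $ i) \<le> K" "0 \<le> K"
    and xi_rv [measurable]: "\<xi> \<in> borel_measurable P"
    and xis_rv [measurable]: "\<And>n. \<xi>s n \<in> borel_measurable P"
    and indep: "indep_vars (\<lambda>_. borel) \<xi>s UNIV"
    and ident: "\<And>n. distr P borel (\<xi>s n) = distr P borel \<xi>"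
    and G_borel: "(\<lambda>(y, z). G y z) \<in> borel_measurable borel"
    and G_int: "\<And>y. integrable P (\<lambda>\<omega>. G y (\<xi> \<omega>))"
    and M_pos: "0 < M"
    and G_sq: "\<And>y. y \<in> X \<Longrightarrow> (\<integral>\<^sup>+\<omega>. ennreal ((norm (G y (\<xi> \<omega>)))\<^sup>2) \<partial>P) \<le> ennreal (M\<^sup>2)"
    and \<alpha>: "0 < \<alpha>" and \<beta>: "0 \<le> \<beta>" "\<beta> < 1" and \<gamma>: "0 \<le> \<gamma>" "\<gamma> < 1"
    and run: "\<And>\<omega>. \<omega> \<in> space P \<Longrightarrow>
        algorithm_run X G (\<lambda>_. \<alpha>) (\<lambda>_. \<beta>) \<gamma> x0 m0
          (\<lambda>n. \<xi>s n \<omega>) (\<lambda>n. diag_mat (h n \<omega>)) (\<lambda>n. x n \<omega>) (\<lambda>n. m n \<omega>) (\<lambda>n. d n \<omega>)"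
    and x_fun: "\<And>n. \<exists>\<phi> \<in> borel_measurable (Pi\<^sub>M {..<n} (\<lambda>_. borel)).
        \<forall>\<omega>\<in>space P. x n \<omega> = \<phi> (\<lambda>k\<in>{..<n}. \<xi>s k \<omega>)"
begin

definition mean_grad :: "real ^ 'd \<Rightarrow> real ^ 'd" where
  "mean_grad y = (\<integral>\<omega>. G y (\<xi> \<omega>) \<partial>P)"

definition diam_bound :: real where
  "diam_bound = sqrt (D * real CARD('d))"

text \<open>
  The indicator of the event that the first gradient sample, the only one taken at a point possibly
  outside \<open>X\<close>, has norm at most \<open>R\<close>.
\<close>
definition keep :: "real \<Rightarrow> 'w \<Rightarrow> real" where
  "keep R \<omega> = of_bool (norm (G x0 (\<xi>s 0 \<omega>)) \<le> R)"

lemma measurable_G [measurable (raw)]: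
  assumes [measurable]: "y \<in> borel_measurable N" "z \<in> borel_measurable N"
  shows "(\<lambda>\<omega>. G (y \<omega>) (z \<omega>)) \<in> borel_measurable N"
proof -
  have "(\<lambda>\<omega>. (y \<omega>, z \<omega>)) \<in> borel_measurable N" by measurable
  from measurable_compose[OF this G_borel] show ?thesis by simp
qed

lemma measurable_mean_grad [measurable]: "mean_grad \<in> borel_measurable borel"
  unfolding mean_grad_def by measurable

lemma measurable_keep [measurable]: "keep R \<in> borel_measurable P"
  unfolding keep_def by measurable

lemma keep_bounds: "0 \<le> keep R \<omega>" "keep R \<omega> \<le> 1"
  by (auto simp: keep_def)

lemma x_0: "\<omega> \<in> space P \<Longrightarrow> x 0 \<omega> = x0"
  using run by (auto simp: algorithm_run_def)

lemma m_0: "\<omega> \<in> space P \<Longrightarrow> m 0 \<omega> = \<beta> *\<^sub>R m0 + (1 - \<beta>) *\<^sub>R G x0 (\<xi>s 0 \<omega>)"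
  using run x_0 by (auto simp: algorithm_run_def)

lemma m_Suc:
  "\<omega> \<in> space P \<Longrightarrow> m (Suc n) \<omega> = \<beta> *\<^sub>R m n \<omega> + (1 - \<beta>) *\<^sub>R G (x (Suc n) \<omega>) (\<xi>s (Suc n) \<omega>)"
  using run by (auto simp: algorithm_run_def)

lemma d_eq: "\<omega> \<in> space P \<Longrightarrow> diag_mat (h n \<omega>) *v d n \<omega> = - (m n \<omega> /\<^sub>R (1 - \<gamma> ^ Suc n))"
  using run by (auto simp: algorithm_run_def)

lemma x_Suc: "\<omega> \<in> space P \<Longrightarrow> x (Suc n) \<omega> = proj_wrt X (diag_mat (h n \<omega>)) (x n \<omega> + \<alpha> *\<^sub>R d n \<omega>)"
  using run by (auto simp: algorithm_run_def)

lemma x_in_X: "\<omega> \<in> space P \<Longrightarrow> x (Suc n) \<omega> \<in> X"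
  unfolding x_Suc by (intro proj_wrt_minimizes(1) compact_X X_ne less_imp_le h_pos)

lemma measurable_x [measurable]: "x n \<in> borel_measurable P"
proof -
  obtain \<phi> where [measurable]: "\<phi> \<in> borel_measurable (Pi\<^sub>M {..<n} (\<lambda>_. borel))"
    and \<phi>: "\<And>\<omega>. \<omega> \<in> space P \<Longrightarrow> x n \<omega> = \<phi> (\<lambda>k\<in>{..<n}. \<xi>s k \<omega>)"
    using x_fun by blast
  have "(\<lambda>\<omega>. \<phi> (\<lambda>k\<in>{..<n}. \<xi>s k \<omega>)) \<in> borel_measurable P" by measurable
  then show ?thesis by (subst measurable_cong[OF \<phi>])
qed

lemma measurable_m [measurable]: "m n \<in> borel_measurable P"
proof (induction n)
  case 0
  show ?case by (subst measurable_cong[OF m_0]) measurable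
next
  case (Suc n)
  note [measurable] = Suc.IH
  show ?case by (subst measurable_cong[OF m_Suc]) measurable
qed

lemma bias_correction: "1 - \<gamma> \<le> 1 - \<gamma> ^ Suc n" "1 - \<gamma> ^ Suc n \<le> 1"
  using power_le_one[OF \<gamma>(1), of n] \<gamma> by (auto intro: mult_left_le)

lemma diam: "z \<in> X \<Longrightarrow> z' \<in> X \<Longrightarrow> norm (z - z') \<le> diam_bound"
  unfolding diam_bound_def by (rule norm_sq_le_coord_bound) (simp add: D)

lemma D_nonneg: "0 \<le> D"
  using X_ne D by (meson all_not_in_conv order_trans zero_le_power2)

lemma diam_bound_nonneg: "0 \<le> diam_bound"
  using D_nonneg by (simp add: diam_bound_def)

section \<open>The stochastic gradients along the run\<close>

lemma norm_mean_grad: "y \<in> X \<Longrightarrow> norm (mean_grad y) \<le> M"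
proof -
  assume y: "y \<in> X"
  have fin: "(\<integral>\<^sup>+\<omega>. ennreal ((norm (G y (\<xi> \<omega>)))\<^sup>2) \<partial>P) < \<infinity>"
    using G_sq[OF y] by (rule order_le_less_trans) simp
  have sq: "integrable P (\<lambda>\<omega>. (norm (G y (\<xi> \<omega>)))\<^sup>2)"
    by (rule integrableI_nonneg) (use fin in auto)
  have "(\<integral>\<omega>. (norm (G y (\<xi> \<omega>)))\<^sup>2 \<partial>P) \<le> M\<^sup>2"
    using G_sq[OF y] by (simp add: nn_integral_eq_integral[OF sq])
  moreover have "norm (mean_grad y) \<le> (\<integral>\<omega>. norm (G y (\<xi> \<omega>)) \<partial>P)"
    unfolding mean_grad_def by (rule integral_norm_bound)
  moreover have "(\<integral>\<omega>. norm (G y (\<xi> \<omega>)) \<partial>P) \<le> ((\<integral>\<omega>. (norm (G y (\<xi> \<omega>)))\<^sup>2 \<partial>P) / M + M) / 2"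
    by (rule integral_norm_le_second_moment(2)[OF _ sq M_pos]) measurable
  ultimately have "norm (mean_grad y) \<le> (M\<^sup>2 / M + M) / 2"
    using M_pos by (smt (verit) divide_right_mono)
  then show ?thesis by (simp add: power2_eq_square)
qed

lemma law_past_present:
  "distr P (Pi\<^sub>M {..<n} (\<lambda>_. borel) \<Otimes>\<^sub>M borel) (\<lambda>\<omega>. (\<lambda>k\<in>{..<n}. \<xi>s k \<omega>, \<xi>s n \<omega>))
    = distr P (Pi\<^sub>M {..<n} (\<lambda>_. borel)) (\<lambda>\<omega>. \<lambda>k\<in>{..<n}. \<xi>s k \<omega>) \<Otimes>\<^sub>M distr P borel \<xi>"
  using indep_vars_past_present[OF indep, of n] by (simp only: ident)

text \<open>
  From step one on the iterate lies in \<open>X\<close>; it is a function of the earlier samples, so freezing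
  these reduces the claim to the moment bound at a fixed point of \<open>X\<close>.
\<close>
lemma oracle_second_moment:
  shows "integrable P (\<lambda>\<omega>. (norm (G (x (Suc n) \<omega>) (\<xi>s (Suc n) \<omega>)))\<^sup>2)"
    and "(\<integral>\<omega>. (norm (G (x (Suc n) \<omega>) (\<xi>s (Suc n) \<omega>)))\<^sup>2 \<partial>P) \<le> M\<^sup>2"
proof -
  let ?U = "\<lambda>\<omega>. \<lambda>k\<in>{..<Suc n}. \<xi>s k \<omega>"
  obtain \<phi> where [measurable]: "\<phi> \<in> borel_measurable (Pi\<^sub>M {..<Suc n} (\<lambda>_. borel))"
    and \<phi>: "\<And>\<omega>. \<omega> \<in> space P \<Longrightarrow> x (Suc n) \<omega> = \<phi> (?U \<omega>)"
    using x_fun by blast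
  let ?g = "\<lambda>(u, z). ennreal ((norm (G (\<phi> u) z))\<^sup>2)"
  have "(\<integral>\<^sup>+\<omega>. ennreal ((norm (G (x (Suc n) \<omega>) (\<xi>s (Suc n) \<omega>)))\<^sup>2) \<partial>P)
      = (\<integral>\<^sup>+\<omega>. ?g (?U \<omega>, \<xi>s (Suc n) \<omega>) \<partial>P)"
    by (rule nn_integral_cong) (simp add: \<phi>)
  also have "\<dots> = (\<integral>\<^sup>+\<omega>. (\<integral>\<^sup>+\<omega>'. ?g (?U \<omega>, \<xi> \<omega>') \<partial>P) \<partial>P)"
    by (rule nn_integral_freeze[OF _ _ xi_rv law_past_present]) measurable
  also have "\<dots> \<le> (\<integral>\<^sup>+\<omega>. ennreal (M\<^sup>2) \<partial>P)"
    using G_sq[OF x_in_X] by (intro nn_integral_mono) (simp flip: \<phi>)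
  also have "\<dots> = ennreal (M\<^sup>2)" by (simp add: emeasure_space_1)
  finally have le: "(\<integral>\<^sup>+\<omega>. ennreal ((norm (G (x (Suc n) \<omega>) (\<xi>s (Suc n) \<omega>)))\<^sup>2) \<partial>P) \<le> ennreal (M\<^sup>2)" .
  then have "(\<integral>\<^sup>+\<omega>. ennreal ((norm (G (x (Suc n) \<omega>) (\<xi>s (Suc n) \<omega>)))\<^sup>2) \<partial>P) < \<infinity>"
    by (rule order_le_less_trans) simp
  then show sq: "integrable P (\<lambda>\<omega>. (norm (G (x (Suc n) \<omega>) (\<xi>s (Suc n) \<omega>)))\<^sup>2)"
    by (intro integrableI_nonneg) auto
  show "(\<integral>\<omega>. (norm (G (x (Suc n) \<omega>) (\<xi>s (Suc n) \<omega>)))\<^sup>2 \<partial>P) \<le> M\<^sup>2"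
    using le by (simp add: nn_integral_eq_integral[OF sq])
qed

lemma integrable_inner_displacement:
  assumes y: "y \<in> X" and f: "integrable P f"
  shows "integrable P (\<lambda>\<omega>. (x (Suc n) \<omega> - y) \<bullet> f \<omega>)"
    and "\<bar>\<integral>\<omega>. (x (Suc n) \<omega> - y) \<bullet> f \<omega> \<partial>P\<bar> \<le> diam_bound * (\<integral>\<omega>. norm (f \<omega>) \<partial>P)"
proof -
  note [measurable] = borel_measurable_integrable[OF f]
  have le: "\<bar>(x (Suc n) \<omega> - y) \<bullet> f \<omega>\<bar> \<le> diam_bound * norm (f \<omega>)" if "\<omega> \<in> space P" for \<omega>
    using diam[OF x_in_X[OF that] y] by (meson Cauchy_Schwarz_ineq2 mult_right_mono norm_ge_zero order_trans)
  have int: "integrable P (\<lambda>\<omega>. diam_bound * norm (f \<omega>))" using f by simp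
  show i: "integrable P (\<lambda>\<omega>. (x (Suc n) \<omega> - y) \<bullet> f \<omega>)"
    by (rule Bochner_Integration.integrable_bound[OF int])
       (use le diam_bound_nonneg in \<open>auto intro!: AE_I2\<close>)
  have "\<bar>\<integral>\<omega>. (x (Suc n) \<omega> - y) \<bullet> f \<omega> \<partial>P\<bar> \<le> (\<integral>\<omega>. \<bar>(x (Suc n) \<omega> - y) \<bullet> f \<omega>\<bar> \<partial>P)"
    by (rule integral_abs_bound)
  also have "\<dots> \<le> (\<integral>\<omega>. diam_bound * norm (f \<omega>) \<partial>P)"
    by (rule integral_mono[OF _ int le]) (use i in auto)
  finally show "\<bar>\<integral>\<omega>. (x (Suc n) \<omega> - y) \<bullet> f \<omega> \<partial>P\<bar> \<le> diam_bound * (\<integral>\<omega>. norm (f \<omega>) \<partial>P)"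
    by simp
qed

lemma integrable_oracle: "integrable P (\<lambda>\<omega>. G (x (Suc n) \<omega>) (\<xi>s (Suc n) \<omega>))"
  by (rule integral_norm_le_second_moment(1)[OF _ oracle_second_moment(1) M_pos]) measurable

lemma integrable_mean_grad_x: "integrable P (\<lambda>\<omega>. mean_grad (x (Suc n) \<omega>))"
  by (rule Bochner_Integration.integrable_bound[of P "\<lambda>_. M"])
     (use norm_mean_grad[OF x_in_X] in \<open>auto intro!: AE_I2 order_trans[OF _ abs_ge_self]\<close>)

lemma integrable_keep:
  fixes f :: "'w \<Rightarrow> 'b::euclidean_space"
  assumes "integrable P f"
  shows "integrable P (\<lambda>\<omega>. keep R \<omega> *\<^sub>R f \<omega>)"
  by (rule Bochner_Integration.integrable_bound[OF assms])
     (use assms keep_bounds in \<open>auto intro!: AE_I2 mult_left_le_one_le\<close>)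

text \<open>
  Both the iterate and the indicator \<open>keep R\<close> are functions of the samples before step \<open>Suc n\<close>: the
  indicator depends on the sample with index \<open>0\<close> only. Freezing them leaves the mean of the oracle at
  a fixed point.
\<close>
lemma oracle_unbiased:
  assumes y: "y \<in> X"
  shows "(\<integral>\<omega>. (x (Suc n) \<omega> - y) \<bullet> (keep R \<omega> *\<^sub>R G (x (Suc n) \<omega>) (\<xi>s (Suc n) \<omega>)) \<partial>P)
    = (\<integral>\<omega>. (x (Suc n) \<omega> - y) \<bullet> (keep R \<omega> *\<^sub>R mean_grad (x (Suc n) \<omega>)) \<partial>P)"
proof -
  let ?U = "\<lambda>\<omega>. \<lambda>k\<in>{..<Suc n}. \<xi>s k \<omega>"
  obtain \<phi> where [measurable]: "\<phi> \<in> borel_measurable (Pi\<^sub>M {..<Suc n} (\<lambda>_. borel))"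
    and \<phi>: "\<And>\<omega>. \<omega> \<in> space P \<Longrightarrow> x (Suc n) \<omega> = \<phi> (?U \<omega>)"
    using x_fun by blast
  let ?k = "\<lambda>u :: nat \<Rightarrow> 'k. of_bool (norm (G x0 (u 0)) \<le> R) :: real"
  let ?g = "\<lambda>(u, z). (\<phi> u - y) \<bullet> (?k u *\<^sub>R G (\<phi> u) z)"
  have keep: "keep R \<omega> = ?k (?U \<omega>)" for \<omega> by (simp add: keep_def)
  have 1: "(x (Suc n) \<omega> - y) \<bullet> (keep R \<omega> *\<^sub>R G (x (Suc n) \<omega>) (\<xi>s (Suc n) \<omega>)) = ?g (?U \<omega>, \<xi>s (Suc n) \<omega>)"
    if "\<omega> \<in> space P" for \<omega>
    using that by (simp only: \<phi> keep prod.case)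
  have 2: "(x (Suc n) \<omega> - y) \<bullet> (keep R \<omega> *\<^sub>R mean_grad (x (Suc n) \<omega>)) = (\<integral>\<omega>'. ?g (?U \<omega>, \<xi> \<omega>') \<partial>P)"
    if "\<omega> \<in> space P" for \<omega>
    unfolding \<phi>[OF that] keep using G_int by (simp add: mean_grad_def)
  have int: "integrable P (\<lambda>\<omega>. ?g (?U \<omega>, \<xi>s (Suc n) \<omega>))"
    using integrable_inner_displacement(1)[OF y integrable_keep[OF integrable_oracle]]
    by (subst Bochner_Integration.integrable_cong[OF refl 1[symmetric]])
  have "(\<integral>\<omega>. ?g (?U \<omega>, \<xi>s (Suc n) \<omega>) \<partial>P) = (\<integral>\<omega>. (\<integral>\<omega>'. ?g (?U \<omega>, \<xi> \<omega>') \<partial>P) \<partial>P)"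
    by (rule integral_freeze[OF _ _ xi_rv law_past_present _ int]) measurable
  then show ?thesis
    by (simp only: 1 2 cong: Bochner_Integration.integral_cong)
qed

section \<open>The truncated gap\<close>

text \<open>
  On the event \<open>keep R\<close> the momentum \<open>m 0\<close> is bounded, which starts the recursion for the second
  moments; \<open>C\<close> is its second moment there.
\<close>
lemma kept_momentum_moments:
  assumes R: "0 \<le> R"
  obtains C where "0 \<le> C"
    and "\<And>n. integrable P (\<lambda>\<omega>. (norm (keep R \<omega> *\<^sub>R m n \<omega>))\<^sup>2)"
    and "\<And>n. (\<integral>\<omega>. (norm (keep R \<omega> *\<^sub>R m n \<omega>))\<^sup>2 \<partial>P) \<le> M\<^sup>2 + \<beta> ^ n * C"
    and "\<And>n. integrable P (\<lambda>\<omega>. keep R \<omega> *\<^sub>R m n \<omega>)"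
    and "\<And>n. (\<integral>\<omega>. norm (keep R \<omega> *\<^sub>R m n \<omega>) \<partial>P) \<le> M + \<beta> ^ n * C / (2 * M)"
proof -
  let ?p = "\<lambda>n \<omega>. keep R \<omega> *\<^sub>R m n \<omega>" and ?g = "\<lambda>n \<omega>. keep R \<omega> *\<^sub>R G (x n \<omega>) (\<xi>s n \<omega>)"
  define C where "C = (\<integral>\<omega>. (norm (?p 0 \<omega>))\<^sup>2 \<partial>P)"
  have C: "0 \<le> C" unfolding C_def by (rule integral_nonneg_AE) simp
  have p0: "integrable P (\<lambda>\<omega>. (norm (?p 0 \<omega>))\<^sup>2)"
  proof (rule Bochner_Integration.integrable_bound[of P "\<lambda>_. (\<beta> * norm m0 + (1 - \<beta>) * R)\<^sup>2"])
    have "norm (?p 0 \<omega>) \<le> \<beta> * norm m0 + (1 - \<beta>) * R" if "\<omega> \<in> space P" for \<omega>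
    proof (cases "norm (G x0 (\<xi>s 0 \<omega>)) \<le> R")
      case True
      have "norm (m 0 \<omega>) \<le> \<beta> * norm m0 + (1 - \<beta>) * norm (G x0 (\<xi>s 0 \<omega>))"
        unfolding m_0[OF that] using \<beta> by (intro norm_triangle_le) simp
      also have "\<dots> \<le> \<beta> * norm m0 + (1 - \<beta>) * R"
        using True \<beta> by (intro add_left_mono mult_left_mono) auto
      finally show ?thesis using True by (simp add: keep_def)
    qed (use \<beta> R in \<open>simp add: keep_def\<close>)
    then show "AE \<omega> in P. norm ((norm (?p 0 \<omega>))\<^sup>2) \<le> norm ((\<beta> * norm m0 + (1 - \<beta>) * R)\<^sup>2)"
      by (intro AE_I2) (simp add: power_mono)
  qed auto
  have g: "integrable P (\<lambda>\<omega>. (norm (?g (Suc n) \<omega>))\<^sup>2)" "(\<integral>\<omega>. (norm (?g (Suc n) \<omega>))\<^sup>2 \<partial>P) \<le> M\<^sup>2" for n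
  proof -
    have le: "(norm (?g (Suc n) \<omega>))\<^sup>2 \<le> (norm (G (x (Suc n) \<omega>) (\<xi>s (Suc n) \<omega>)))\<^sup>2" for \<omega>
      by (simp add: keep_def)
    show int: "integrable P (\<lambda>\<omega>. (norm (?g (Suc n) \<omega>))\<^sup>2)"
      by (rule Bochner_Integration.integrable_bound[OF oracle_second_moment(1)]) (use le in auto)
    show "(\<integral>\<omega>. (norm (?g (Suc n) \<omega>))\<^sup>2 \<partial>P) \<le> M\<^sup>2"
      by (rule order_trans[OF integral_mono[OF int oracle_second_moment(1) le] oracle_second_moment(2)])
  qed
  have S: "integrable P (\<lambda>\<omega>. (norm (?p n \<omega>))\<^sup>2) \<and> (\<integral>\<omega>. (norm (?p n \<omega>))\<^sup>2 \<partial>P) \<le> M\<^sup>2 + \<beta> ^ n * C" for n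
    by (rule momentum_second_moment[where g = ?g])
       (use p0 g \<beta> in \<open>auto simp: m_Suc C_def algebra_simps\<close>)
  have N: "integrable P (?p n)" "(\<integral>\<omega>. norm (?p n \<omega>) \<partial>P) \<le> M + \<beta> ^ n * C / (2 * M)" for n
  proof -
    note * = integral_norm_le_second_moment[of "?p n", OF _ conjunct1[OF S] M_pos]
    show "integrable P (?p n)" by (rule *(1)) measurable
    have "(\<integral>\<omega>. norm (?p n \<omega>) \<partial>P) \<le> ((\<integral>\<omega>. (norm (?p n \<omega>))\<^sup>2 \<partial>P) / M + M) / 2"
      by (rule *(2)) measurable
    also have "\<dots> \<le> ((M\<^sup>2 + \<beta> ^ n * C) / M + M) / 2"
      using S[of n] M_pos by (intro divide_right_mono add_right_mono) auto
    also have "\<dots> = M + \<beta> ^ n * C / (2 * M)"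
      using M_pos by (simp add: field_simps power2_eq_square)
    finally show "(\<integral>\<omega>. norm (?p n \<omega>) \<partial>P) \<le> M + \<beta> ^ n * C / (2 * M)" .
  qed
  show thesis using that[OF C] S N by blast
qed

text \<open>
  This averages \<open>projected_step_descent\<close> over the event selected by \<open>keep R\<close>. As the indicator takes only the values \<open>0\<close> and \<open>1\<close>, it may be moved inside the squared norm.
\<close>
lemma expected_descent:
  assumes y: "y \<in> X"
    and int: "integrable P (\<lambda>\<omega>. (norm (keep R \<omega> *\<^sub>R m (Suc n) \<omega>))\<^sup>2)" "integrable P (\<lambda>\<omega>. keep R \<omega> *\<^sub>R m (Suc n) \<omega>)"
  defines "V \<equiv> \<lambda>k. (\<integral>\<omega>. keep R \<omega> * diag_norm_sq (h (Suc n) \<omega>) (x (Suc k) \<omega> - y) \<partial>P)"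
    and "a \<equiv> 1 - \<gamma> ^ Suc (Suc n)"
  shows "2 * \<alpha> * ((\<integral>\<omega>. (x (Suc n) \<omega> - y) \<bullet> (keep R \<omega> *\<^sub>R m (Suc n) \<omega>) \<partial>P) / a)
    \<le> V n - V (Suc n) + \<alpha>\<^sup>2 * K * ((\<integral>\<omega>. (norm (keep R \<omega> *\<^sub>R m (Suc n) \<omega>))\<^sup>2 \<partial>P) / a\<^sup>2)"
proof -
  let ?p = "\<lambda>\<omega>. keep R \<omega> *\<^sub>R m (Suc n) \<omega>"
  let ?v = "\<lambda>k \<omega>. keep R \<omega> * diag_norm_sq (h (Suc n) \<omega>) (x (Suc k) \<omega> - y)"
  have iv: "integrable P (?v k)" for k
    by (rule integrable_weighted_diag_norm_sq(1)[where D = D])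
       (use keep_bounds h_int less_imp_le[OF h_pos] D[OF x_in_X y] in auto)
  note ii = integrable_inner_displacement(1)[OF y int(2), of n]
  have "(\<integral>\<omega>. 2 * \<alpha> * (((x (Suc n) \<omega> - y) \<bullet> ?p \<omega>) / a) \<partial>P)
      \<le> (\<integral>\<omega>. ?v n \<omega> - ?v (Suc n) \<omega> + \<alpha>\<^sup>2 * K * ((norm (?p \<omega>))\<^sup>2 / a\<^sup>2) \<partial>P)"
  proof (rule integral_mono_AE)
    show "AE \<omega> in P. 2 * \<alpha> * (((x (Suc n) \<omega> - y) \<bullet> ?p \<omega>) / a)
        \<le> ?v n \<omega> - ?v (Suc n) \<omega> + \<alpha>\<^sup>2 * K * ((norm (?p \<omega>))\<^sup>2 / a\<^sup>2)"
      using K(1)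
    proof (rule AE_mp, intro AE_I2 impI)
      fix \<omega> assume \<omega>: "\<omega> \<in> space P" and K: "\<forall>n i. inverse (h n \<omega> $ i) \<le> K"
      have "2 * \<alpha> * ((x (Suc n) \<omega> - y) \<bullet> (m (Suc n) \<omega> /\<^sub>R a))
        \<le> diag_norm_sq (h (Suc n) \<omega>) (x (Suc n) \<omega> - y) - diag_norm_sq (h (Suc n) \<omega>) (x (Suc (Suc n)) \<omega> - y)
          + \<alpha>\<^sup>2 * K * (norm (m (Suc n) \<omega> /\<^sub>R a))\<^sup>2"
        unfolding x_Suc[OF \<omega>, of "Suc n"] a_def
        by (rule projected_step_descent[OF compact_X convex_X h_pos[OF \<omega>] y d_eq[OF \<omega>]]) (use K in auto)
      then show "2 * \<alpha> * (((x (Suc n) \<omega> - y) \<bullet> ?p \<omega>) / a)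
          \<le> ?v n \<omega> - ?v (Suc n) \<omega> + \<alpha>\<^sup>2 * K * ((norm (?p \<omega>))\<^sup>2 / a\<^sup>2)"
        by (cases "norm (G x0 (\<xi>s 0 \<omega>)) \<le> R")
           (simp_all add: keep_def divide_inverse power_mult_distrib power_inverse mult_ac)
    qed
  qed (use iv ii int(1) in auto)
  then show ?thesis
    using iv ii int(1) by (simp add: V_def)
qed

text \<open>
  The potential \<open>\<Psi>\<close> has two parts: the expected weighted distance minus \<open>D\<close> times the
  expected weights, and a multiple of \<open>\<beta> ^ n\<close>. The latter has differences proportional to
  \<open>\<beta> ^ n\<close> and so absorbs the contribution of \<open>m 0\<close> to the moments.
\<close>
lemma kept_gap_bound:
  assumes y: "y \<in> X" and R: "0 \<le> R"
  defines "e \<equiv> \<lambda>n. (\<integral>\<omega>. (x (Suc n) \<omega> - y) \<bullet> (keep R \<omega> *\<^sub>R mean_grad (x (Suc n) \<omega>)) \<partial>P)"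
  obtains \<Psi> :: "nat \<Rightarrow> real" and L where "\<And>n. L \<le> \<Psi> n"
    and "\<And>n. 0 \<le> e n \<Longrightarrow> e n \<le> K * M\<^sup>2 / (2 * (1 - \<beta>) * (1 - \<gamma>)\<^sup>2) * \<alpha>
            + M * diam_bound / ((1 - \<beta>) * (1 - \<gamma>)) * \<beta> + (\<Psi> n - \<Psi> (Suc n))"
proof -
  let ?p = "\<lambda>n \<omega>. keep R \<omega> *\<^sub>R m n \<omega>"
  obtain C where C: "0 \<le> C"
    and S: "\<And>n. integrable P (\<lambda>\<omega>. (norm (?p n \<omega>))\<^sup>2)"
      "\<And>n. (\<integral>\<omega>. (norm (?p n \<omega>))\<^sup>2 \<partial>P) \<le> M\<^sup>2 + \<beta> ^ n * C"
    and N: "\<And>n. integrable P (?p n)" "\<And>n. (\<integral>\<omega>. norm (?p n \<omega>) \<partial>P) \<le> M + \<beta> ^ n * C / (2 * M)"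
    using kept_momentum_moments[OF R] by blast
  define V where "V j k = (\<integral>\<omega>. keep R \<omega> * diag_norm_sq (h (Suc j) \<omega>) (x (Suc k) \<omega> - y) \<partial>P)" for j k
  define \<Phi> where "\<Phi> k = V k k - D * (\<Sum>i\<in>UNIV. \<integral>\<omega>. h (Suc k) \<omega> $ i \<partial>P)" for k
  define b where "b = 1 - \<beta>"
  define g where "g = 1 - \<gamma>"
  have b: "0 < b" and g: "0 < g" using \<beta> \<gamma> by (auto simp: b_def g_def)
  define Q where "Q = (\<alpha> * K * \<beta> * C / (2 * g\<^sup>2) + \<beta> * diam_bound * C / (2 * M * g)) / b"
  define \<Psi> where "\<Psi> k = \<Phi> k / (2 * \<alpha> * b) + Q / b * \<beta> ^ k" for k
  have Q: "0 \<le> Q"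
    unfolding Q_def using \<alpha> \<beta> K(2) C M_pos diam_bound_nonneg b g by auto
  have V_nonneg: "0 \<le> V k k" for k
    unfolding V_def
    by (rule integrable_weighted_diag_norm_sq(2)[where D = D])
       (use keep_bounds h_int less_imp_le[OF h_pos] D[OF x_in_X y] in auto)
  have \<Phi>_lower: "- (D * T) \<le> \<Phi> k" for k
  proof -
    have "D * (\<Sum>i\<in>UNIV. \<integral>\<omega>. h (Suc k) \<omega> $ i \<partial>P) \<le> D * T"
      by (intro mult_left_mono h_bound D_nonneg)
    then show ?thesis using V_nonneg[of k] unfolding \<Phi>_def by linarith
  qed
  have lower: "- (D * T) / (2 * \<alpha> * b) \<le> \<Psi> k" for k
  proof -
    have "- (D * T) / (2 * \<alpha> * b) \<le> \<Phi> k / (2 * \<alpha> * b)"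
      using \<alpha> b by (intro divide_right_mono \<Phi>_lower) auto
    moreover have "0 \<le> Q / b * \<beta> ^ k" using Q b \<beta> by auto
    ultimately show ?thesis unfolding \<Psi>_def by linarith
  qed
  have "e n \<le> K * M\<^sup>2 / (2 * b * g\<^sup>2) * \<alpha> + M * diam_bound / (b * g) * \<beta> + (\<Psi> n - \<Psi> (Suc n))"
    if e: "0 \<le> e n" for n
  proof -
    let ?I = "\<integral>\<omega>. (x (Suc n) \<omega> - y) \<bullet> ?p (Suc n) \<omega> \<partial>P"
    let ?J = "\<integral>\<omega>. (x (Suc n) \<omega> - y) \<bullet> ?p n \<omega> \<partial>P"
    let ?G = "\<lambda>\<omega>. keep R \<omega> *\<^sub>R G (x (Suc n) \<omega>) (\<xi>s (Suc n) \<omega>)"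
    have "?I = (\<integral>\<omega>. \<beta> * ((x (Suc n) \<omega> - y) \<bullet> ?p n \<omega>) + b * ((x (Suc n) \<omega> - y) \<bullet> ?G \<omega>) \<partial>P)"
      by (rule Bochner_Integration.integral_cong[OF refl])
         (simp add: m_Suc b_def inner_add_right algebra_simps)
    also have "\<dots> = \<beta> * ?J + b * (\<integral>\<omega>. (x (Suc n) \<omega> - y) \<bullet> ?G \<omega> \<partial>P)"
      using integrable_inner_displacement(1)[OF y N(1), of n n]
        integrable_inner_displacement(1)[OF y integrable_keep[OF integrable_oracle], of n R n]
      by simp
    finally have split: "?I = \<beta> * ?J + b * e n"
      unfolding oracle_unbiased[OF y] e_def .
    have J: "- (diam_bound * (\<integral>\<omega>. norm (?p n \<omega>) \<partial>P)) \<le> ?J"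
      using integrable_inner_displacement(2)[OF y N(1), of n n] by linarith
    have step: "V n n - V n (Suc n) \<le> \<Phi> n - \<Phi> (Suc n)"
    proof -
      have "V (Suc n) (Suc n) - D * (\<Sum>i\<in>UNIV. \<integral>\<omega>. h (Suc (Suc n)) \<omega> $ i \<partial>P)
          \<le> V n (Suc n) - D * (\<Sum>i\<in>UNIV. \<integral>\<omega>. h (Suc n) \<omega> $ i \<partial>P)"
        unfolding V_def
        by (rule weighted_distance_potential)
           (use keep_bounds h_int h_mono less_imp_le[OF h_pos] D[OF x_in_X y] in auto)
      then show ?thesis unfolding \<Phi>_def by linarith
    qed
    have "e n \<le> K * M\<^sup>2 / (2 * b * g\<^sup>2) * \<alpha> + M * diam_bound / (b * g) * \<beta>
        + (V n n - V n (Suc n)) / (2 * \<alpha> * b) + Q * \<beta> ^ n"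
      unfolding Q_def
    proof (rule gap_bound_arith[OF _ _ g b \<alpha> \<beta>(1) K(2) M_pos diam_bound_nonneg _ split J _ _ _ _ e])
      show "2 * \<alpha> * (?I / (1 - \<gamma> ^ Suc (Suc n))) \<le> V n n - V n (Suc n)
          + \<alpha>\<^sup>2 * K * ((\<integral>\<omega>. (norm (?p (Suc n) \<omega>))\<^sup>2 \<partial>P) / (1 - \<gamma> ^ Suc (Suc n))\<^sup>2)"
        unfolding V_def by (rule expected_descent[OF y S(1) N(1)])
      show "(\<integral>\<omega>. (norm (?p (Suc n) \<omega>))\<^sup>2 \<partial>P) \<le> M\<^sup>2 + \<beta> ^ n * \<beta> * C"
        using S(2)[of "Suc n"] by (simp add: mult.commute)
      show "g \<le> 1 - \<gamma> ^ Suc (Suc n)" "1 - \<gamma> ^ Suc (Suc n) \<le> 1"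
        unfolding g_def by (rule bias_correction)+
      show "0 \<le> (\<integral>\<omega>. (norm (?p (Suc n) \<omega>))\<^sup>2 \<partial>P)" "0 \<le> (\<integral>\<omega>. norm (?p n \<omega>) \<partial>P)"
        by (auto intro!: integral_nonneg_AE)
    qed (rule N(2))
    also have "\<dots> \<le> K * M\<^sup>2 / (2 * b * g\<^sup>2) * \<alpha> + M * diam_bound / (b * g) * \<beta>
        + (\<Phi> n - \<Phi> (Suc n)) / (2 * \<alpha> * b) + Q * \<beta> ^ n"
      using step \<alpha> b by (intro add_mono divide_right_mono order_refl) auto
    also have "Q * \<beta> ^ n = Q / b * \<beta> ^ n - Q / b * \<beta> ^ Suc n"
    proof -
      have "\<beta> ^ n - \<beta> ^ Suc n = \<beta> ^ n * b" by (simp add: b_def algebra_simps)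
      then have "Q * \<beta> ^ n = Q / b * (\<beta> ^ n - \<beta> ^ Suc n)"
        using b by simp
      then show ?thesis by (simp only: right_diff_distrib)
    qed
    finally show ?thesis
      by (simp add: \<Psi>_def diff_divide_distrib)
  qed
  then show thesis
    unfolding b_def g_def by (rule that[OF lower])
qed

section \<open>Removing the truncation\<close>

text \<open>
  Off the event \<open>keep R\<close> the norm of the first sample exceeds \<open>R\<close>, so the lost mass is at most its
  expectation divided by \<open>R\<close>; the mean gradient on \<open>X\<close> is bounded by \<open>M\<close>.
\<close>
lemma truncation_error:
  assumes y: "y \<in> X" and R: "0 < R"
  shows "\<bar>(\<integral>\<omega>. (x (Suc n) \<omega> - y) \<bullet> mean_grad (x (Suc n) \<omega>) \<partial>P)
      - (\<integral>\<omega>. (x (Suc n) \<omega> - y) \<bullet> (keep R \<omega> *\<^sub>R mean_grad (x (Suc n) \<omega>)) \<partial>P)\<bar>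
    \<le> diam_bound * (M * (\<integral>\<omega>. norm (G x0 (\<xi> \<omega>)) \<partial>P) / R)"
proof -
  let ?g = "\<lambda>\<omega>. mean_grad (x (Suc n) \<omega>)"
  let ?r = "\<lambda>\<omega>. ?g \<omega> - keep R \<omega> *\<^sub>R ?g \<omega>"
  have ir: "integrable P ?r"
    by (intro Bochner_Integration.integrable_diff integrable_mean_grad_x integrable_keep)
  have iG: "integrable P (\<lambda>\<omega>. G x0 (\<xi>s 0 \<omega>))"
  proof -
    have "integrable (distr P borel \<xi>) (G x0)"
      by (subst integrable_distr_eq) (use G_int in auto)
    then show ?thesis
      unfolding ident[of 0, symmetric] by (subst (asm) integrable_distr_eq) auto
  qed
  have eG: "(\<integral>\<omega>. norm (G x0 (\<xi>s 0 \<omega>)) \<partial>P) = (\<integral>\<omega>. norm (G x0 (\<xi> \<omega>)) \<partial>P)"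
  proof -
    have "(\<integral>z. norm (G x0 z) \<partial>distr P borel (\<xi>s 0)) = (\<integral>z. norm (G x0 z) \<partial>distr P borel \<xi>)"
      unfolding ident ..
    then show ?thesis by (simp add: integral_distr)
  qed
  have "(\<integral>\<omega>. norm (?r \<omega>) \<partial>P) \<le> (\<integral>\<omega>. M * norm (G x0 (\<xi>s 0 \<omega>)) / R \<partial>P)"
  proof (rule integral_mono)
    fix \<omega> assume \<omega>: "\<omega> \<in> space P"
    show "norm (?r \<omega>) \<le> M * norm (G x0 (\<xi>s 0 \<omega>)) / R"
    proof (cases "norm (G x0 (\<xi>s 0 \<omega>)) \<le> R")
      case False
      have "norm (?r \<omega>) = norm (?g \<omega>)" using False by (simp add: keep_def)
      also have "\<dots> \<le> M" by (rule norm_mean_grad[OF x_in_X[OF \<omega>]])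
      also have "\<dots> \<le> M * norm (G x0 (\<xi>s 0 \<omega>)) / R"
        using False R M_pos by (simp add: field_simps)
      finally show ?thesis .
    qed (use M_pos R in \<open>simp add: keep_def\<close>)
  qed (use ir iG in auto)
  also have "\<dots> = M * (\<integral>\<omega>. norm (G x0 (\<xi> \<omega>)) \<partial>P) / R"
    by (simp add: eG)
  finally have "diam_bound * (\<integral>\<omega>. norm (?r \<omega>) \<partial>P) \<le> diam_bound * (M * (\<integral>\<omega>. norm (G x0 (\<xi> \<omega>)) \<partial>P) / R)"
    by (rule mult_left_mono[OF _ diam_bound_nonneg])
  moreover have "(\<integral>\<omega>. (x (Suc n) \<omega> - y) \<bullet> ?r \<omega> \<partial>P)
      = (\<integral>\<omega>. (x (Suc n) \<omega> - y) \<bullet> ?g \<omega> \<partial>P) - (\<integral>\<omega>. (x (Suc n) \<omega> - y) \<bullet> (keep R \<omega> *\<^sub>R ?g \<omega>) \<partial>P)"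
    unfolding inner_diff_right[of "x (Suc n) _ - y"]
    by (intro Bochner_Integration.integral_diff integrable_inner_displacement(1)[OF y]
        integrable_mean_grad_x integrable_keep)
  ultimately show ?thesis
    using integrable_inner_displacement(2)[OF y ir, of n] by linarith
qed

text \<open>
  If the limit superior were smaller, the gap would eventually exceed \<open>c + \<delta>\<close>. For \<open>R\<close> so large that
  the truncation costs at most \<open>\<delta> / 2\<close>, the potential would then drop by \<open>\<delta> / 2\<close> in every late step.
\<close>
theorem limsup_gap:
  assumes y: "y \<in> X"
  shows "limsup (\<lambda>n. ereal (\<integral>\<omega>. (y - x n \<omega>) \<bullet> mean_grad (x n \<omega>) \<partial>P))
    \<ge> ereal (- (K * M\<^sup>2 / (2 * (1 - \<beta>) * (1 - \<gamma>)\<^sup>2) * \<alpha> + M * diam_bound / ((1 - \<beta>) * (1 - \<gamma>)) * \<beta>))"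
proof (rule ccontr)
  define c where "c = K * M\<^sup>2 / (2 * (1 - \<beta>) * (1 - \<gamma>)\<^sup>2) * \<alpha> + M * diam_bound / ((1 - \<beta>) * (1 - \<gamma>)) * \<beta>"
  define u where "u n = (\<integral>\<omega>. (x (Suc n) \<omega> - y) \<bullet> mean_grad (x (Suc n) \<omega>) \<partial>P)" for n
  have c0: "0 \<le> c"
    unfolding c_def using K(2) \<alpha> \<beta> \<gamma> M_pos diam_bound_nonneg by auto
  assume "\<not> ?thesis"
  then have "limsup (\<lambda>n. ereal (\<integral>\<omega>. (y - x n \<omega>) \<bullet> mean_grad (x n \<omega>) \<partial>P)) < ereal (- c)"
    unfolding c_def by (simp only: not_le)
  from ereal_dense2[OF this] obtain q where
    q: "limsup (\<lambda>n. ereal (\<integral>\<omega>. (y - x n \<omega>) \<bullet> mean_grad (x n \<omega>) \<partial>P)) < ereal q" "q < - c"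
    by auto
  define \<delta> where "\<delta> = - q - c"
  have \<delta>: "0 < \<delta>" using q(2) by (simp add: \<delta>_def)
  have "eventually (\<lambda>n. ereal (\<integral>\<omega>. (y - x n \<omega>) \<bullet> mean_grad (x n \<omega>) \<partial>P) < ereal q) sequentially"
    by (rule Limsup_lessD[OF q(1)])
  then have "eventually (\<lambda>n. ereal (\<integral>\<omega>. (y - x (Suc n) \<omega>) \<bullet> mean_grad (x (Suc n) \<omega>) \<partial>P) < ereal q) sequentially"
    by (subst (asm) eventually_sequentially_Suc[symmetric])
  then have ev: "eventually (\<lambda>n. c + \<delta> < u n) sequentially"
  proof (rule eventually_mono)
    fix n assume *: "ereal (\<integral>\<omega>. (y - x (Suc n) \<omega>) \<bullet> mean_grad (x (Suc n) \<omega>) \<partial>P) < ereal q"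
    have "(\<integral>\<omega>. (y - x (Suc n) \<omega>) \<bullet> mean_grad (x (Suc n) \<omega>) \<partial>P) = - u n"
    proof -
      have "(y - z) \<bullet> w = - ((z - y) \<bullet> w)" for z w :: "real ^ 'd"
        by (metis inner_minus_left minus_diff_eq)
      then show ?thesis by (simp add: u_def)
    qed
    then show "c + \<delta> < u n" using * by (simp add: \<delta>_def)
  qed
  define A where "A = diam_bound * (M * (\<integral>\<omega>. norm (G x0 (\<xi> \<omega>)) \<partial>P))"
  have A: "0 \<le> A"
    unfolding A_def using diam_bound_nonneg M_pos by (auto intro!: mult_nonneg_nonneg integral_nonneg_AE)
  define R where "R = 2 * A / \<delta> + 1"
  have R: "0 < R" using A \<delta> by (auto simp: R_def intro: add_nonneg_pos)
  have AR: "A / R \<le> \<delta> / 2"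
  proof -
    have "A \<le> \<delta> / 2 * R" using \<delta> by (simp add: R_def distrib_left)
    then show ?thesis using R by (simp add: pos_divide_le_eq)
  qed
  define e where "e n = (\<integral>\<omega>. (x (Suc n) \<omega> - y) \<bullet> (keep R \<omega> *\<^sub>R mean_grad (x (Suc n) \<omega>)) \<partial>P)" for n
  have near: "u n \<le> e n + \<delta> / 2" for n
  proof -
    have "\<bar>u n - e n\<bar> \<le> A / R"
      using truncation_error[OF y R, of n] by (simp add: u_def e_def A_def)
    then show ?thesis using AR by linarith
  qed
  obtain \<Psi> L where L: "\<And>n. L \<le> \<Psi> n" and \<Psi>: "\<And>n. 0 \<le> e n \<Longrightarrow> e n \<le> c + (\<Psi> n - \<Psi> (Suc n))"
    by (rule kept_gap_bound[OF y less_imp_le[OF R], folded c_def e_def]) (rule that; assumption)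
  from ev have "eventually (\<lambda>n. \<delta> / 2 \<le> \<Psi> n - \<Psi> (Suc n)) sequentially"
  proof (rule eventually_mono)
    fix n assume "c + \<delta> < u n"
    then have "c + \<delta> / 2 \<le> e n" using near[of n] by (simp add: field_simps)
    then show "\<delta> / 2 \<le> \<Psi> n - \<Psi> (Suc n)"
      using \<Psi>[of n] c0 \<delta> by linarith
  qed
  then show False
    using not_eventually_potential_decrease[OF L, of "\<delta> / 2"] \<delta> by simp
qed

end

theorem theorem3p1:
  fixes P :: "'w measure"
    and X :: "(real ^ 'd) set"
    and \<Xi> :: "(real ^ 'k) set"
    and \<xi> :: "'w \<Rightarrow> real ^ 'k"
    and \<xi>s :: "nat \<Rightarrow> 'w \<Rightarrow> real ^ 'k"
    and F :: "real ^ 'd \<Rightarrow> real ^ 'k \<Rightarrow> real"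
    and f :: "real ^ 'd \<Rightarrow> real"
    and G :: "real ^ 'd \<Rightarrow> real ^ 'k \<Rightarrow> real ^ 'd"
    and h :: "nat \<Rightarrow> 'w \<Rightarrow> real ^ 'd"
    and x m d :: "nat \<Rightarrow> 'w \<Rightarrow> real ^ 'd"
    and x0 m0 :: "real ^ 'd"
    and \<alpha> \<beta> \<gamma> M D Mt Bt bt \<gamma>t :: real
  assumes prob: "prob_space P"
    and xi_rv: "\<xi> \<in> borel_measurable P"
    and xi_supp: "AE z in distr P borel \<xi>. z \<in> \<Xi>"
    and A1: "X \<noteq> {}" "closed X" "convex X"
    and A2_int: "\<And>y. integrable P (\<lambda>\<omega>. F y (\<xi> \<omega>))"
    and A2_f: "\<And>y. f y = (\<integral>\<omega>. F y (\<xi> \<omega>) \<partial>P)"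
    and A2_C1: "AE z in distr P borel \<xi>. z \<in> \<Xi> \<longrightarrow> continuously_differentiable (\<lambda>y. F y z)"
    and f_diff: "\<And>y. f differentiable (at y)"
    and h_rv: "\<And>n. h n \<in> borel_measurable P"
    and h_pos: "\<And>n \<omega> i. \<omega> \<in> space P \<Longrightarrow> h n \<omega> $ i > 0"
    and A3: "\<And>n i. AE \<omega> in P. h (Suc n) \<omega> $ i \<ge> h n \<omega> $ i"
    and A4: "\<And>i. \<exists>B>0. (SUP n. \<integral>\<^sup>+\<omega>. ennreal (h n \<omega> $ i) \<partial>P) \<le> ennreal B"
    and A5: "coord_diameter_sq X < \<infinity>"
    and D: "D = real_of_ereal (coord_diameter_sq X)"
    and C1_rv: "\<And>n. \<xi>s n \<in> borel_measurable P"
    and C1_indep: "prob_space.indep_vars P (\<lambda>_. borel) \<xi>s UNIV"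
    and C1_ident: "\<And>n. distr P borel (\<xi>s n) = distr P borel \<xi>"
    and C2_meas: "(\<lambda>(y, z). G y z) \<in> borel_measurable borel"
    and C2_int: "\<And>y. integrable P (\<lambda>\<omega>. G y (\<xi> \<omega>))"
    and C2: "\<And>y. (\<integral>\<omega>. G y (\<xi> \<omega>) \<partial>P) = gradient f y"
    and M_pos: "M > 0"
    and C3: "\<And>y. y \<in> X \<Longrightarrow> (\<integral>\<^sup>+\<omega>. ennreal ((norm (G y (\<xi> \<omega>)))\<^sup>2) \<partial>P) \<le> ennreal (M\<^sup>2)"
    and \<alpha>: "0 < \<alpha>" "\<alpha> < 1"
    and \<beta>: "0 \<le> \<beta>" "\<beta> < 1"
    and \<gamma>: "0 \<le> \<gamma>" "\<gamma> < 1"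
    and run: "\<And>\<omega>. \<omega> \<in> space P \<Longrightarrow>
        algorithm_run X G (\<lambda>_. \<alpha>) (\<lambda>_. \<beta>) \<gamma> x0 m0
          (\<lambda>n. \<xi>s n \<omega>) (\<lambda>n. diag_mat (h n \<omega>)) (\<lambda>n. x n \<omega>) (\<lambda>n. m n \<omega>) (\<lambda>n. d n \<omega>)"
    and x_fun: "\<And>n. \<exists>\<phi> \<in> borel_measurable (Pi\<^sub>M {..<n} (\<lambda>_. borel)).
        \<forall>\<omega>\<in>space P. x n \<omega> = \<phi> (\<lambda>k\<in>{..<n}. \<xi>s k \<omega>)"
    and \<gamma>t: "\<gamma>t = 1 - \<gamma>"
    and bt: "bt = 1 - \<beta>"
    and Mt: "Mt = sqrt (max ((norm m0)\<^sup>2) (M\<^sup>2))"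
    and Bt_fin: "inv_sqrt_bound P h < \<infinity>"
    and Bt: "Bt = real_of_ereal (inv_sqrt_bound P h)"
  shows "\<forall>y\<in>X. limsup (\<lambda>n. ereal (\<integral>\<omega>. (y - x n \<omega>) \<bullet> gradient f (x n \<omega>) \<partial>P))
      \<ge> ereal (- (Bt\<^sup>2 * Mt\<^sup>2) / (2 * bt * \<gamma>t\<^sup>2) * \<alpha>
               - (Mt * sqrt (D * real CARD('d))) / (bt * \<gamma>t) * \<beta>)"
proof
  fix y assume y: "y \<in> X"
  interpret prob_space P by (rule prob)
  have Dz: "(z $ i - z' $ i)\<^sup>2 \<le> D" if "z \<in> X" "z' \<in> X" for z z' i
    unfolding D by (rule coord_diameter_sq_bound[OF A5 that])
  \<comment> \<open>Finite coordinate widths make the closed set \<open>X\<close> bounded, hence compact.\<close>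
  have "X \<subseteq> cball y (sqrt (D * real CARD('d)))"
    using norm_sq_le_coord_bound[of "y - z" D for z] Dz[OF y] by (auto simp: dist_norm)
  then have compact_X: "compact X"
    using A1(2) bounded_subset[OF bounded_cball] by (auto simp: compact_eq_bounded_closed)
  have h_nn: "AE \<omega> in P. 0 \<le> h n \<omega> $ i" for n i
    using h_pos by (auto intro!: AE_I2 less_imp_le)
  have h_meas: "(\<lambda>\<omega>. h n \<omega> $ i) \<in> borel_measurable P" for n i
    using h_rv by measurable
  obtain B where B: "\<And>i. 0 < B i" "\<And>i. (SUP n. \<integral>\<^sup>+\<omega>. ennreal (h n \<omega> $ i) \<partial>P) \<le> ennreal (B i)"
    using A4 by metis
  have hB: "(\<integral>\<^sup>+\<omega>. ennreal (h n \<omega> $ i) \<partial>P) \<le> ennreal (B i)" for n i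
    by (rule order_trans[OF SUP_upper B(2)]) simp
  have h_int: "integrable P (\<lambda>\<omega>. h n \<omega> $ i)" for n i
    by (rule integrableI_nonneg[OF h_meas h_nn order_le_less_trans[OF hB]]) simp
  have h_le: "(\<integral>\<omega>. h n \<omega> $ i \<partial>P) \<le> B i" for n i
    using hB[of n i] B(1)[of i] by (simp add: nn_integral_eq_integral[OF h_int h_nn] ennreal_le_iff)
  interpret R: bounded_momentum_run P X \<xi> \<xi>s G h x m d x0 m0 \<alpha> \<beta> \<gamma> M D "Bt\<^sup>2" "\<Sum>i\<in>UNIV. B i"
  proof unfold_locales
    show "AE \<omega> in P. \<forall>n i. inverse (h n \<omega> $ i) \<le> Bt\<^sup>2"
      unfolding Bt using prob h_pos Bt_fin by (rule inv_sqrt_bound_AE)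
    show "(\<Sum>i\<in>UNIV. \<integral>\<omega>. h n \<omega> $ i \<partial>P) \<le> (\<Sum>i\<in>UNIV. B i)" for n
      by (intro sum_mono h_le)
  qed (fact compact_X A1 Dz h_rv h_pos A3 h_int xi_rv C1_rv C1_indep C1_ident C2_meas C2_int M_pos C3
        \<alpha>(1) \<beta> \<gamma> run x_fun zero_le_power2)+
  have grad: "R.mean_grad = gradient f"
    by (simp add: fun_eq_iff R.mean_grad_def C2)
  have "M \<le> Mt" unfolding Mt by (rule real_le_rsqrt) simp
  then have M_le: "M\<^sup>2 \<le> Mt\<^sup>2" "M \<le> Mt" using M_pos by (auto intro: power_mono)
  have b: "0 < bt" and g: "0 < \<gamma>t" using \<beta> \<gamma> by (auto simp: bt \<gamma>t)
  have "Bt\<^sup>2 * M\<^sup>2 / (2 * bt * \<gamma>t\<^sup>2) * \<alpha> + M * R.diam_bound / (bt * \<gamma>t) * \<beta>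
      \<le> Bt\<^sup>2 * Mt\<^sup>2 / (2 * bt * \<gamma>t\<^sup>2) * \<alpha> + Mt * R.diam_bound / (bt * \<gamma>t) * \<beta>"
    using M_le b g \<alpha> \<beta> R.diam_bound_nonneg
    by (intro add_mono mult_right_mono divide_right_mono mult_left_mono) auto
  then have "ereal (- (Bt\<^sup>2 * Mt\<^sup>2) / (2 * bt * \<gamma>t\<^sup>2) * \<alpha> - Mt * sqrt (D * real CARD('d)) / (bt * \<gamma>t) * \<beta>)
      \<le> ereal (- (Bt\<^sup>2 * M\<^sup>2 / (2 * bt * \<gamma>t\<^sup>2) * \<alpha> + M * R.diam_bound / (bt * \<gamma>t) * \<beta>))"
    by (simp add: R.diam_bound_def)
  also have "\<dots> \<le> limsup (\<lambda>n. ereal (\<integral>\<omega>. (y - x n \<omega>) \<bullet> gradient f (x n \<omega>) \<partial>P))"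
    using R.limsup_gap[OF y] unfolding grad bt \<gamma>t .
  finally show "ereal (- (Bt\<^sup>2 * Mt\<^sup>2) / (2 * bt * \<gamma>t\<^sup>2) * \<alpha> - Mt * sqrt (D * real CARD('d)) / (bt * \<gamma>t) * \<beta>)
      \<le> limsup (\<lambda>n. ereal (\<integral>\<omega>. (y - x n \<omega>) \<bullet> gradient f (x n \<omega>) \<partial>P))" .
qed

end
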